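(* Consider the problem $$(MP)\qquad \text{minimize } Ef_0(x)\ \text{ over } x\in\mathcal N\ \text{ subject to } f_j(x)\le0,\ j=1,\dots,l,\quad f_j(x)=0,\ j=l+1,\dots,m\quad\text{a.s.}$$ and the problem $$(D_{MP})\qquad \text{maximize } E\inf_{x\in\mathbb R^n}\{f_0(x)+y\cdot H(x)-x\cdot p\}\ \text{ over }(p,y)\in\mathcal X_a^\perp\times\mathcal Y\ \text{ subject to } y\in K^*\ \text{a.s.}$$ If $\operatorname{dom}Ef\cap(\mathcal X\times\mathcal U)\neq\emptyset$ (i.e. $Ef(x,u)<\infty$ for some $(x,u)\in\mathcal X\times\mathcal U$) and $(MP)$ and $(D_{MP})$ are feasible, then the following are equivalent: 1. $x$ solves $(MP)$, $(p,y)$ solves $(D_{MP})$ and $\inf(MP)=\sup(D_{MP})$; 2. $x$ is feasible in $(MP)$, $(p,y)$ is feasible in $(D_{MP})$ and, almost surely, $$p\in\partial_x[f_0+y\cdot H](x),\qquad H(x)\in K,\quad y\in K^*,\quad y\cdot H(x)=0.$$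
   Context: $(\Omega,\mathcal F,P)$ is a probability space with a filtration $(\mathcal F_t)_{t=0}^T$ (an increasing sequence of sub-$\sigma$-algebras of $\mathcal F$). $n=n_0+\dots+n_T$ and $\mathcal N$ is the linear space of all $x=(x_t)_{t=0}^T\in L^0(\mathbb R^n)$ such that $x_t$ is $\mathbb R^{n_t}$-valued and $\mathcal F_t$-measurable for every $t$. Random variables equal a.s. are identified. Convention: the expectation of an extended real-valued random variable is $+\infty$ unless its positive part is integrable. A convex normal integrand on $\mathbb R^n\times\Omega$ is an extended real-valued function $g$ such that $g(\cdot,\omega)$ is closed convex for every $\omega$ (closed: lower semicontinuous and either proper or identically $+\infty$ or identically $-\infty$) and $\omega\mapsto\operatorname{epi}g(\cdot,\omega)$ is measurable. $f_0,\dots,f_m$ are convex normal integrands on $\mathbb R^n\times\Omega$; $f_1,\dots,f_m$ do not take the value $-\infty$ and $f_j(\cdot,\omega)$ is (real-valued) affine for $j>l$. $K:=\mathbb R_-^l\times\{0\}\subset\mathbb R^m$, with polar cone $K^*:=\{y\in\mathbb R^m: u\cdot y\le0\ \forall u\in K\}=\mathbb R_+^l\times\mathbb R^{m-l}$. $\operatorname{dom}H(\cdot,\omega):=\bigcap_{j=1}^m\operatorname{dom}f_j(\cdot,\omega)$ and $H(x,\omega):=(f_j(x,\omega))_{j=1}^m$ for $x\in\operatorname{dom}H(\cdot,\omega)$. The function $f_0+y\cdot H$ is understood as $+\infty$ outside $\operatorname{dom}H(\cdot,\omega)$. $\partial_x$ is the $\omega$-wise convex subdifferential in $x$ (empty where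 the function is not finite). $f(x,u,\omega):=f_0(x,\omega)$ if $x\in\operatorname{dom}H(\cdot,\omega)$ and $H(x,\omega)+u\in K$, and $:=+\infty$ otherwise. $Ef(x,u):=\int f(x(\omega),u(\omega),\omega)dP(\omega)$, and $f^*(v,y,\omega)=\sup_{x,u}\{x\cdot v+u\cdot y-f(x,u,\omega)\}$; for $y\in K^*$, $-f^*(p,y)=\inf_{x}\{f_0(x)+y\cdot H(x)-x\cdot p\}$. The objective of $(D_{MP})$ is to be read as $-Ef^*(p,y)$. A linear space $\mathcal U$ of $\mathbb R^m$-valued random variables is decomposable if $1_Au+1_{\Omega\setminus A}u'\in\mathcal U$ for all $u\in\mathcal U$, $u'\in L^\infty$, $A\in\mathcal F$; it is solid if $\bar u\in\mathcal U$, $u\in L^0$ and $|u^i|\le|\bar u^i|$ a.s. for all $i$ imply $u\in\mathcal U$. $\mathcal X,\mathcal V$ are solid decomposable spaces of $\mathbb R^n$-valued random variables in separating duality under $\langle x,v\rangle:=E[x\cdot v]$, and $\mathcal U,\mathcal Y$ are solid decomposable spaces of $\mathbb R^m$-valued random variables in separating duality under $\langle u,y\rangle:=E[u\cdot y]$. $\mathcal X_a:=\mathcal X\cap\mathcal N$, $\mathcal X_a^\perp:=\{v\in\mathcal V:\langle x,v\rangle=0\ \forall x\in\mathcal X_a\}$. $x$ is feasible in $(MP)$ if $x\in\mathcal N$ satisfies the constraints and $Ef_0(x)<\infty$; $(p,y)$ is feasible in $(D_{MP})$ if $(p,y)\in\mathcal X_a^\perp\times\mathcal Y$, $y\in K^*$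 a.s. and $Ef^*(p,y)<\infty$; a problem is feasible if it has a feasible point. "Solves" means feasible and attaining the optimum value. *)

theory Defs
  imports "HOL-Probability.Probability"
begin

section \<open>Extended real-valued convex functions\<close>

definition epi :: "('b \<Rightarrow> ereal) \<Rightarrow> ('b \<times> real) set" where
  "epi g = {(x, \<alpha>). g x \<le> ereal \<alpha>}"

definition eff_dom :: "('b \<Rightarrow> ereal) \<Rightarrow> 'b set" where
  "eff_dom g = {x. g x < \<infinity>}"

definition lsc :: "('b::topological_space \<Rightarrow> ereal) \<Rightarrow> bool" where
  "lsc g \<longleftrightarrow> (\<forall>a. open {x. a < g x})"

definition proper_fun :: "('b \<Rightarrow> ereal) \<Rightarrow> bool" where
  "proper_fun g \<longleftrightarrow> (\<forall>x. g x \<noteq> -\<infinity>) \<and> eff_dom g \<noteq> {}"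

definition closed_fun :: "('b::topological_space \<Rightarrow> ereal) \<Rightarrow> bool" where
  "closed_fun g \<longleftrightarrow> lsc g \<and> (proper_fun g \<or> (\<forall>x. g x = \<infinity>) \<or> (\<forall>x. g x = -\<infinity>))"

definition convex_fun :: "('b::real_vector \<Rightarrow> ereal) \<Rightarrow> bool" where
  "convex_fun g \<longleftrightarrow> convex (epi g)"

definition subdiff :: "('b::real_inner \<Rightarrow> ereal) \<Rightarrow> 'b \<Rightarrow> 'b set" where
  "subdiff g x = {v. \<bar>g x\<bar> \<noteq> \<infinity> \<and> (\<forall>z. g x + ereal (v \<bullet> (z - x)) \<le> g z)}"

text \<open>
  Measurability of the epigraphical mapping is meant in the usual sense of set-valued
  mappings: the inverse image of every open set is measurable.
\<close>

definition convex_normal_integrand ::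
    "'a measure \<Rightarrow> ('b::euclidean_space \<Rightarrow> 'a \<Rightarrow> ereal) \<Rightarrow> bool" where
  "convex_normal_integrand M g \<longleftrightarrow>
     (\<forall>\<omega>\<in>space M. closed_fun (\<lambda>x. g x \<omega>) \<and> convex_fun (\<lambda>x. g x \<omega>)) \<and>
     (\<forall>G. open G \<longrightarrow> {\<omega>\<in>space M. epi (\<lambda>x. g x \<omega>) \<inter> G \<noteq> {}} \<in> sets M)"


section \<open>Expectation and spaces of random variables\<close>

text \<open>Since \<^const>\<open>e2ennreal\<close> truncates at zero, the two integrals below are those of the
  positive and of the negative part.\<close>

definition ext_expectation :: "'a measure \<Rightarrow> ('a \<Rightarrow> ereal) \<Rightarrow> ereal" where
  "ext_expectation M g =
     (if (\<integral>\<^sup>+\<omega>. e2ennreal (g \<omega>) \<partial>M) = \<infinity> then \<infinity>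
      else enn2ereal (\<integral>\<^sup>+\<omega>. e2ennreal (g \<omega>) \<partial>M) - enn2ereal (\<integral>\<^sup>+\<omega>. e2ennreal (- g \<omega>) \<partial>M))"

text \<open>
  A space of equivalence classes of random variables is represented by the set of all
  representatives of its elements. Solidity below makes such a set closed under
  almost sure equality.
\<close>

definition linear_rv_space :: "'a measure \<Rightarrow> ('a \<Rightarrow> real^'k) set \<Rightarrow> bool" where
  "linear_rv_space M U \<longleftrightarrow>
     U \<subseteq> borel_measurable M \<and> (\<lambda>\<omega>. 0) \<in> U \<and>
     (\<forall>u\<in>U. \<forall>w\<in>U. (\<lambda>\<omega>. u \<omega> + w \<omega>) \<in> U) \<and>
     (\<forall>c. \<forall>u\<in>U. (\<lambda>\<omega>. c *\<^sub>R u \<omega>) \<in> U)"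

definition L_infty :: "'a measure \<Rightarrow> ('a \<Rightarrow> real^'k) set" where
  "L_infty M = {u \<in> borel_measurable M. \<exists>C. AE \<omega> in M. norm (u \<omega>) \<le> C}"

definition decomposable :: "'a measure \<Rightarrow> ('a \<Rightarrow> real^'k) set \<Rightarrow> bool" where
  "decomposable M U \<longleftrightarrow>
     (\<forall>u\<in>U. \<forall>w\<in>L_infty M. \<forall>A\<in>sets M. (\<lambda>\<omega>. if \<omega> \<in> A then u \<omega> else w \<omega>) \<in> U)"

definition solid :: "'a measure \<Rightarrow> ('a \<Rightarrow> real^'k) set \<Rightarrow> bool" where
  "solid M U \<longleftrightarrow>
     (\<forall>w\<in>U. \<forall>u\<in>borel_measurable M. (AE \<omega> in M. \<forall>i. \<bar>u \<omega> $ i\<bar> \<le> \<bar>w \<omega> $ i\<bar>) \<longrightarrow> u \<in> U)"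

definition pairing :: "'a measure \<Rightarrow> ('a \<Rightarrow> real^'k) \<Rightarrow> ('a \<Rightarrow> real^'k) \<Rightarrow> real" where
  "pairing M u y = (\<integral>\<omega>. u \<omega> \<bullet> y \<omega> \<partial>M)"

definition separating_duality ::
    "'a measure \<Rightarrow> ('a \<Rightarrow> real^'k) set \<Rightarrow> ('a \<Rightarrow> real^'k) set \<Rightarrow> bool" where
  "separating_duality M U Y \<longleftrightarrow>
     (\<forall>u\<in>U. \<forall>y\<in>Y. integrable M (\<lambda>\<omega>. u \<omega> \<bullet> y \<omega>)) \<and>
     (\<forall>u\<in>U. (\<forall>y\<in>Y. pairing M u y = 0) \<longrightarrow> (AE \<omega> in M. u \<omega> = 0)) \<and>
     (\<forall>y\<in>Y. (\<forall>u\<in>U. pairing M u y = 0) \<longrightarrow> (AE \<omega> in M. y \<omega> = 0))"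

definition dual_pair ::
    "'a measure \<Rightarrow> ('a \<Rightarrow> real^'k) set \<Rightarrow> ('a \<Rightarrow> real^'k) set \<Rightarrow> bool" where
  "dual_pair M U Y \<longleftrightarrow>
     linear_rv_space M U \<and> decomposable M U \<and> solid M U \<and>
     linear_rv_space M Y \<and> decomposable M Y \<and> solid M Y \<and>
     separating_duality M U Y"

text \<open>
  The block structure \<open>x = (x\<^sub>0, \<dots>, x\<^sub>T)\<close> of a vector is given by a map \<open>\<tau>\<close> that sends a
  coordinate to its time index: \<open>x\<^sub>t\<close> consists of the coordinates \<open>i\<close> with \<open>\<tau> i = t\<close>, and \<open>n\<^sub>t\<close>
  is the number of these. A process is adapted if its equivalence class is, i.e., up to null sets.
\<close>

definition adapted_space ::
    "'a measure \<Rightarrow> (nat \<Rightarrow> 'a measure) \<Rightarrow> ('n \<Rightarrow> nat) \<Rightarrow> ('a \<Rightarrow> real^'n) set" where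
  "adapted_space M F \<tau> =
     {x \<in> borel_measurable M.
        \<forall>i. \<exists>z \<in> borel_measurable (F (\<tau> i)). AE \<omega> in M. x \<omega> $ i = z \<omega>}"

definition annihilator ::
    "'a measure \<Rightarrow> ('a \<Rightarrow> real^'k) set \<Rightarrow> ('a \<Rightarrow> real^'k) set \<Rightarrow> ('a \<Rightarrow> real^'k) set" where
  "annihilator M V S = {v\<in>V. \<forall>x\<in>S. pairing M x v = 0}"


section \<open>The constraint system\<close>

text \<open>The set \<open>L\<close> collects the indices of the inequality constraints, its complement those of
  the equality constraints.\<close>

definition cone_K :: "'m set \<Rightarrow> (real^'m) set" where
  "cone_K L = {u. (\<forall>j\<in>L. u $ j \<le> 0) \<and> (\<forall>j\<in>-L. u $ j = 0)}"

definition polar_cone :: "'b::real_inner set \<Rightarrow> 'b set" where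
  "polar_cone K = {y. \<forall>u\<in>K. u \<bullet> y \<le> 0}"

definition dom_H :: "('m \<Rightarrow> 'b \<Rightarrow> 'a \<Rightarrow> ereal) \<Rightarrow> 'a \<Rightarrow> 'b set" where
  "dom_H f \<omega> = (\<Inter>j. eff_dom (\<lambda>x. f j x \<omega>))"

text \<open>Meaningful only for \<open>x \<in> dom_H f \<omega>\<close>.\<close>

definition map_H :: "('m \<Rightarrow> 'b \<Rightarrow> 'a \<Rightarrow> ereal) \<Rightarrow> 'b \<Rightarrow> 'a \<Rightarrow> real^'m" where
  "map_H f x \<omega> = (\<chi> j. real_of_ereal (f j x \<omega>))"

definition f0_plus_yH ::
    "('b \<Rightarrow> 'a \<Rightarrow> ereal) \<Rightarrow> ('m \<Rightarrow> 'b \<Rightarrow> 'a \<Rightarrow> ereal) \<Rightarrow> real^'m \<Rightarrow> 'a \<Rightarrow> 'b \<Rightarrow> ereal" where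
  "f0_plus_yH f0 f y \<omega> x =
     (if x \<in> dom_H f \<omega> then f0 x \<omega> + ereal (y \<bullet> map_H f x \<omega>) else \<infinity>)"

definition integrand_f ::
    "'m set \<Rightarrow> ('b \<Rightarrow> 'a \<Rightarrow> ereal) \<Rightarrow> ('m \<Rightarrow> 'b \<Rightarrow> 'a \<Rightarrow> ereal) \<Rightarrow> 'b \<Rightarrow> real^'m \<Rightarrow> 'a \<Rightarrow> ereal" where
  "integrand_f L f0 f x u \<omega> =
     (if x \<in> dom_H f \<omega> \<and> map_H f x \<omega> + u \<in> cone_K L then f0 x \<omega> else \<infinity>)"

definition conj_f ::
    "'m set \<Rightarrow> ('b::real_inner \<Rightarrow> 'a \<Rightarrow> ereal) \<Rightarrow> ('m \<Rightarrow> 'b \<Rightarrow> 'a \<Rightarrow> ereal) \<Rightarrow>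
     'b \<Rightarrow> real^'m \<Rightarrow> 'a \<Rightarrow> ereal" where
  "conj_f L f0 f v y \<omega> = (SUP (x, u). ereal (x \<bullet> v + u \<bullet> y) - integrand_f L f0 f x u \<omega>)"


section \<open>The primal and the dual problem\<close>

definition E_f0 :: "'a measure \<Rightarrow> ('b \<Rightarrow> 'a \<Rightarrow> ereal) \<Rightarrow> ('a \<Rightarrow> 'b) \<Rightarrow> ereal" where
  "E_f0 M f0 x = ext_expectation M (\<lambda>\<omega>. f0 (x \<omega>) \<omega>)"

definition E_f ::
    "'a measure \<Rightarrow> 'm set \<Rightarrow> ('b \<Rightarrow> 'a \<Rightarrow> ereal) \<Rightarrow> ('m \<Rightarrow> 'b \<Rightarrow> 'a \<Rightarrow> ereal) \<Rightarrow>
     ('a \<Rightarrow> 'b) \<Rightarrow> ('a \<Rightarrow> real^'m) \<Rightarrow> ereal" where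
  "E_f M L f0 f x u = ext_expectation M (\<lambda>\<omega>. integrand_f L f0 f (x \<omega>) (u \<omega>) \<omega>)"

definition E_conj_f ::
    "'a measure \<Rightarrow> 'm set \<Rightarrow> ('b::real_inner \<Rightarrow> 'a \<Rightarrow> ereal) \<Rightarrow> ('m \<Rightarrow> 'b \<Rightarrow> 'a \<Rightarrow> ereal) \<Rightarrow>
     ('a \<Rightarrow> 'b) \<Rightarrow> ('a \<Rightarrow> real^'m) \<Rightarrow> ereal" where
  "E_conj_f M L f0 f p y = ext_expectation M (\<lambda>\<omega>. conj_f L f0 f (p \<omega>) (y \<omega>) \<omega>)"

text \<open>In both problems \<open>constr\<close> is the constraint set; a feasible point has in addition
  an objective value different from \<open>\<infinity>\<close> (minimization) or \<open>-\<infinity>\<close> (maximization).\<close>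

definition MP_constr ::
    "'a measure \<Rightarrow> ('a \<Rightarrow> 'b) set \<Rightarrow> 'm set \<Rightarrow> ('m \<Rightarrow> 'b \<Rightarrow> 'a \<Rightarrow> ereal) \<Rightarrow> ('a \<Rightarrow> 'b) set" where
  "MP_constr M N L f =
     {x\<in>N. AE \<omega> in M. (\<forall>j\<in>L. f j (x \<omega>) \<omega> \<le> 0) \<and> (\<forall>j\<in>-L. f j (x \<omega>) \<omega> = 0)}"

definition MP_feasible ::
    "'a measure \<Rightarrow> ('a \<Rightarrow> 'b) set \<Rightarrow> 'm set \<Rightarrow> ('b \<Rightarrow> 'a \<Rightarrow> ereal) \<Rightarrow>
     ('m \<Rightarrow> 'b \<Rightarrow> 'a \<Rightarrow> ereal) \<Rightarrow> ('a \<Rightarrow> 'b) set" where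
  "MP_feasible M N L f0 f = {x \<in> MP_constr M N L f. E_f0 M f0 x < \<infinity>}"

definition MP_inf ::
    "'a measure \<Rightarrow> ('a \<Rightarrow> 'b) set \<Rightarrow> 'm set \<Rightarrow> ('b \<Rightarrow> 'a \<Rightarrow> ereal) \<Rightarrow>
     ('m \<Rightarrow> 'b \<Rightarrow> 'a \<Rightarrow> ereal) \<Rightarrow> ereal" where
  "MP_inf M N L f0 f = (INF x\<in>MP_constr M N L f. E_f0 M f0 x)"

definition MP_solves ::
    "'a measure \<Rightarrow> ('a \<Rightarrow> 'b) set \<Rightarrow> 'm set \<Rightarrow> ('b \<Rightarrow> 'a \<Rightarrow> ereal) \<Rightarrow>
     ('m \<Rightarrow> 'b \<Rightarrow> 'a \<Rightarrow> ereal) \<Rightarrow> ('a \<Rightarrow> 'b) \<Rightarrow> bool" where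
  "MP_solves M N L f0 f x \<longleftrightarrow> x \<in> MP_feasible M N L f0 f \<and> E_f0 M f0 x = MP_inf M N L f0 f"

text \<open>
  The parameter \<open>P\<close> of the dual problem is the space of the variable \<open>p\<close>. For \<open>y\<close> in the polar
  cone, \<open>- conj_f L f0 f p y \<omega>\<close> is the infimum over \<open>x\<close> of \<open>f0 x + y \<bullet> H x - x \<bullet> p\<close>; the dual
  objective is \<open>- E_conj_f\<close>, whose expectation differs from that of \<open>- conj_f\<close> when neither the
  positive nor the negative part is integrable.
\<close>

definition DMP_constr ::
    "'a measure \<Rightarrow> ('a \<Rightarrow> 'b) set \<Rightarrow> ('a \<Rightarrow> real^'m) set \<Rightarrow> 'm set \<Rightarrow>
     (('a \<Rightarrow> 'b) \<times> ('a \<Rightarrow> real^'m)) set" where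
  "DMP_constr M P Y L = {(p, y) \<in> P \<times> Y. AE \<omega> in M. y \<omega> \<in> polar_cone (cone_K L)}"

definition DMP_feasible ::
    "'a measure \<Rightarrow> ('a \<Rightarrow> 'b::real_inner) set \<Rightarrow> ('a \<Rightarrow> real^'m) set \<Rightarrow> 'm set \<Rightarrow>
     ('b \<Rightarrow> 'a \<Rightarrow> ereal) \<Rightarrow> ('m \<Rightarrow> 'b \<Rightarrow> 'a \<Rightarrow> ereal) \<Rightarrow> (('a \<Rightarrow> 'b) \<times> ('a \<Rightarrow> real^'m)) set" where
  "DMP_feasible M P Y L f0 f = {(p, y) \<in> DMP_constr M P Y L. E_conj_f M L f0 f p y < \<infinity>}"

definition DMP_sup ::
    "'a measure \<Rightarrow> ('a \<Rightarrow> 'b::real_inner) set \<Rightarrow> ('a \<Rightarrow> real^'m) set \<Rightarrow> 'm set \<Rightarrow>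
     ('b \<Rightarrow> 'a \<Rightarrow> ereal) \<Rightarrow> ('m \<Rightarrow> 'b \<Rightarrow> 'a \<Rightarrow> ereal) \<Rightarrow> ereal" where
  "DMP_sup M P Y L f0 f = (SUP (p, y)\<in>DMP_constr M P Y L. - E_conj_f M L f0 f p y)"

definition DMP_solves ::
    "'a measure \<Rightarrow> ('a \<Rightarrow> 'b::real_inner) set \<Rightarrow> ('a \<Rightarrow> real^'m) set \<Rightarrow> 'm set \<Rightarrow>
     ('b \<Rightarrow> 'a \<Rightarrow> ereal) \<Rightarrow> ('m \<Rightarrow> 'b \<Rightarrow> 'a \<Rightarrow> ereal) \<Rightarrow> ('a \<Rightarrow> 'b) \<Rightarrow> ('a \<Rightarrow> real^'m) \<Rightarrow> bool" where
  "DMP_solves M P Y L f0 f p y \<longleftrightarrow>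
     (p, y) \<in> DMP_feasible M P Y L f0 f \<and> - E_conj_f M L f0 f p y = DMP_sup M P Y L f0 f"

end

(*
  Fenchel's inequality gives x.p <= f0(x) + f*(p,y) pointwise for feasible x and (p,y). The
  right side has an integrable upper bound, and an adapted x, although not assumed to be in X,
  still satisfies E[x.p] = 0 as soon as the positive part of x.p is integrable. Hence
  E f0(x) + E f*(p,y) is the integral of the nonnegative function f0(x) + f*(p,y) - x.p. It is
  nonnegative, which is weak duality, and it vanishes iff Fenchel's inequality is almost surely
  an equality, which is the subdifferential condition together with complementary slackness.

  E[x.p] = 0 is proved by induction on the number of stages: conditioning p on the last
  sigma-algebra F_T removes the last block, and truncation to the sets where x is bounded keeps
  all products integrable. Measurability of f0(x) and of f*(p,y) comes from closed-valued
  measurable mappings: f*(p,y) is the support function of the common epigraph of f_0, ..., f_m.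
*)
theory Submission
  imports Defs
begin

section \<open>Measurable closed-valued mappings\<close>

definition measurable_set_map :: "'a measure \<Rightarrow> ('a \<Rightarrow> 'b::topological_space set) \<Rightarrow> bool" where
  "measurable_set_map M C \<longleftrightarrow> (\<forall>G. open G \<longrightarrow> {\<omega>\<in>space M. C \<omega> \<inter> G \<noteq> {}} \<in> sets M)"

lemma measurable_set_map_singleton:
  fixes g :: "'a \<Rightarrow> 'b::topological_space"
  assumes "g \<in> borel_measurable M"
  shows "measurable_set_map M (\<lambda>\<omega>. {g \<omega>})"
proof -
  have "{\<omega>\<in>space M. {g \<omega>} \<inter> G \<noteq> {}} = g -` G \<inter> space M" for G by auto
  with assms show ?thesis
    unfolding measurable_set_map_def by (auto intro: measurable_sets)
qed

text \<open>A surjective linear map is open, so whether a preimage meets \<open>G\<close> can be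
  tested on the open image of \<open>G\<close>.\<close>

lemma measurable_set_map_vimage_linear:
  fixes h :: "'b::euclidean_space \<Rightarrow> 'c::euclidean_space"
  assumes "measurable_set_map M C" "linear h" "surj h"
  shows "measurable_set_map M (\<lambda>\<omega>. h -` C \<omega>)"
  unfolding measurable_set_map_def
proof (intro allI impI)
  fix G :: "'b set" assume "open G"
  then have "open (h ` G)"
    using assms(2,3) by (rule open_surjective_linear_image)
  moreover have "{\<omega>\<in>space M. h -` C \<omega> \<inter> G \<noteq> {}} = {\<omega>\<in>space M. C \<omega> \<inter> h ` G \<noteq> {}}" by auto
  ultimately show "{\<omega>\<in>space M. h -` C \<omega> \<inter> G \<noteq> {}} \<in> sets M"
    using assms(1) unfolding measurable_set_map_def by simp
qed

lemma countable_dense_ball_meets: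
  obtains D :: "'b::euclidean_space set"
  where "countable D" "\<And>z e. e > 0 \<Longrightarrow> \<exists>q\<in>D. dist q z < e"
proof -
  obtain D :: "'b set" where D: "countable D" "\<And>X. open X \<Longrightarrow> X \<noteq> {} \<Longrightarrow> \<exists>d\<in>D. d \<in> X"
    using countable_dense_setE by blast
  have "\<exists>q\<in>D. dist q z < e" if "e > 0" for z e
    using D(2)[of "ball z e"] that by (auto simp: dist_commute)
  with D(1) show ?thesis using that by blast
qed

text \<open>Open sets cannot be tested against the members of an intersection one by one. Compact
  sets can in the limit: closed sets share a point of a compact \<open>K\<close> iff for each radius
  a single ball near \<open>K\<close>, centred in a countable dense set, meets all of them. An open
  set is a countable union of compact ones.\<close>

lemma measurable_set_map_INT:
  fixes C :: "'i \<Rightarrow> 'a \<Rightarrow> 'b::euclidean_space set"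
  assumes I: "countable I"
    and meas: "\<And>i. i \<in> I \<Longrightarrow> measurable_set_map M (C i)"
    and clo: "\<And>i \<omega>. i \<in> I \<Longrightarrow> \<omega> \<in> space M \<Longrightarrow> closed (C i \<omega>)"
  shows "measurable_set_map M (\<lambda>\<omega>. \<Inter>i\<in>I. C i \<omega>)"
proof -
  obtain D :: "'b set" where D: "countable D" "\<And>z e. e > 0 \<Longrightarrow> \<exists>q\<in>D. dist q z < e"
    using countable_dense_ball_meets by blast
  define r where "r k = inverse (real (Suc k))" for k
  have r: "r k > 0" for k by (simp add: r_def)
  have r0: "r \<longlonglongrightarrow> 0" unfolding r_def by (rule LIMSEQ_inverse_real_of_nat)
  have compact: "{\<omega>\<in>space M. (\<Inter>i\<in>I. C i \<omega>) \<inter> K \<noteq> {}} \<in> sets M" if "compact K" for K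
  proof -
    \<comment> \<open>By compactness the closed sets meet in \<open>K\<close> iff small balls centred in \<open>D\<close> meet all of them.\<close>
    let ?D = "\<lambda>k. {q\<in>D. K \<inter> ball q (r k) \<noteq> {}}"
    let ?S = "{\<omega>\<in>space M. \<forall>k. \<exists>q\<in>?D k. \<forall>i\<in>I. C i \<omega> \<inter> ball q (r k) \<noteq> {}}"
    have "(\<Inter>i\<in>I. C i \<omega>) \<inter> K \<noteq> {}"
      if \<omega>: "\<omega> \<in> space M" and near: "\<forall>k. \<exists>q\<in>?D k. \<forall>i\<in>I. C i \<omega> \<inter> ball q (r k) \<noteq> {}" for \<omega>
    proof -
      obtain q where q: "\<And>k. K \<inter> ball (q k) (r k) \<noteq> {}"
        "\<And>k i. i \<in> I \<Longrightarrow> C i \<omega> \<inter> ball (q k) (r k) \<noteq> {}"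
        using near by simp metis
      obtain z where z: "\<And>k. z k \<in> K" "\<And>k. dist (q k) (z k) < r k"
        using q(1) by (simp add: disjoint_iff) metis
      \<comment> \<open>The subsequence is extracted from the points of \<open>K\<close> alone,
        before \<open>i\<close> is fixed, so that one limit \<open>l\<close> serves all the closed
        sets: points in the same shrinking balls have the same limit.\<close>
      obtain l s where l: "l \<in> K" "strict_mono s" "(z \<circ> s) \<longlonglongrightarrow> l"
        using \<open>compact K\<close> z(1) unfolding compact_def by metis
      have rs: "(r \<circ> s) \<longlonglongrightarrow> 0" using LIMSEQ_subseq_LIMSEQ[OF r0 l(2)] .
      have "l \<in> C i \<omega>" if i: "i \<in> I" for i
      proof -
        obtain c where c: "\<And>k. c k \<in> C i \<omega>" "\<And>k. dist (q k) (c k) < r k"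
          using q(2)[OF i] by (simp add: disjoint_iff) metis
        have cz: "norm (c (s k) - z (s k)) \<le> 2 * r (s k)" for k
          using dist_triangle2[of "c (s k)" "z (s k)" "q (s k)"] c(2)[of "s k"] z(2)[of "s k"]
          by (simp add: dist_commute dist_norm)
        have "(\<lambda>k. 2 * r (s k)) \<longlonglongrightarrow> 0"
          using tendsto_mult_right_zero[OF rs, of 2] by (simp add: o_def)
        then have "(\<lambda>k. c (s k) - z (s k)) \<longlonglongrightarrow> 0"
          using cz by (rule Lim_null_comparison[OF always_eventually[OF allI], rotated])
        with l(3) have "(\<lambda>k. c (s k)) \<longlonglongrightarrow> l"
          unfolding o_def by (rule Lim_transform)
        then show ?thesis
          using closed_sequentially[OF clo[OF i \<omega>], of "\<lambda>k. c (s k)"] c(1) by simp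
      qed
      with l(1) show ?thesis by blast
    qed
    moreover have "\<forall>k. \<exists>q\<in>?D k. \<forall>i\<in>I. C i \<omega> \<inter> ball q (r k) \<noteq> {}"
      if ne: "(\<Inter>i\<in>I. C i \<omega>) \<inter> K \<noteq> {}" for \<omega>
    proof
      fix k
      obtain z where z: "z \<in> K" "\<And>i. i \<in> I \<Longrightarrow> z \<in> C i \<omega>" using ne by blast
      obtain q where q: "q \<in> D" "dist q z < r k" using D(2)[OF r] by blast
      then have "z \<in> ball q (r k)" by simp
      with q(1) show "\<exists>q\<in>?D k. \<forall>i\<in>I. C i \<omega> \<inter> ball q (r k) \<noteq> {}"
        using z by blast
    qed
    ultimately have "{\<omega>\<in>space M. (\<Inter>i\<in>I. C i \<omega>) \<inter> K \<noteq> {}} = ?S" by blast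
    also have "\<dots> \<in> sets M"
      using meas D(1) unfolding measurable_set_map_def
      by (intro sets.sets_Collect_countable_All sets.sets_Collect_countable_Ex'
          sets.sets_Collect_countable_All' I) (auto intro: countable_subset)
    finally show ?thesis .
  qed
  show ?thesis
    unfolding measurable_set_map_def
  proof (intro allI impI)
    fix G :: "'b set" assume "open G"
    then obtain K :: "nat \<Rightarrow> 'b set" where K: "\<And>n. compact (K n)" "\<Union>(range K) = G"
      using open_Union_compact_subsets by metis
    have "{\<omega>\<in>space M. (\<Inter>i\<in>I. C i \<omega>) \<inter> G \<noteq> {}} = (\<Union>n. {\<omega>\<in>space M. (\<Inter>i\<in>I. C i \<omega>) \<inter> K n \<noteq> {}})"
      using K(2) by blast
    then show "{\<omega>\<in>space M. (\<Inter>i\<in>I. C i \<omega>) \<inter> G \<noteq> {}} \<in> sets M"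
      using compact K(1) by auto
  qed
qed

text \<open>This is the support function of \<open>C \<omega>\<close> at \<open>c \<omega>\<close>.
  It exceeds \<open>a\<close> iff some ball of a countable family meets \<open>C \<omega>\<close>
  and the Cauchy-Schwarz lower bound of the linear form over this ball exceeds \<open>a\<close>.
  Both conditions are measurable for a fixed ball.\<close>

lemma borel_measurable_SUP_set_map:
  fixes c :: "'a \<Rightarrow> 'b::euclidean_space"
  assumes C: "measurable_set_map M C" and [measurable]: "c \<in> borel_measurable M"
  shows "(\<lambda>\<omega>. SUP z\<in>C \<omega>. ereal (c \<omega> \<bullet> z)) \<in> borel_measurable M"
  unfolding borel_measurable_ereal_iff_Ioi
proof
  fix a :: ereal
  obtain D :: "'b set" where D: "countable D" "\<And>z e. e > 0 \<Longrightarrow> \<exists>q\<in>D. dist q z < e"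
    using countable_dense_ball_meets by blast
  define r where "r k = inverse (real (Suc k))" for k
  have r: "r k > 0" for k by (simp add: r_def)
  let ?P = "\<lambda>\<omega> q k. C \<omega> \<inter> ball q (r k) \<noteq> {} \<and> a < ereal (c \<omega> \<bullet> q - norm (c \<omega>) * r k)"
  have "(a < (SUP z\<in>C \<omega>. ereal (c \<omega> \<bullet> z))) \<longleftrightarrow> (\<exists>q\<in>D. \<exists>k. ?P \<omega> q k)" for \<omega>
  proof
    assume "a < (SUP z\<in>C \<omega>. ereal (c \<omega> \<bullet> z))"
    then obtain z where z: "z \<in> C \<omega>" "a < ereal (c \<omega> \<bullet> z)" by (auto simp: less_SUP_iff)
    then obtain b where b: "a < ereal b" "b < c \<omega> \<bullet> z"
      using ereal_dense2 by (metis ereal_less_ereal_Ex less_ereal.simps(1))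
    \<comment> \<open>The factor 2 pays for two errors of size at most
      \<open>norm (c \<omega>) * r k\<close>: moving from \<open>z\<close> to the centre
      \<open>q\<close>, and the lower bound over the ball around \<open>q\<close>. The added 1 keeps
      the denominator positive if \<open>c \<omega>\<close> is zero.\<close>
    obtain k where k: "r k < (c \<omega> \<bullet> z - b) / (2 * (norm (c \<omega>) + 1))"
      using reals_Archimedean[of "(c \<omega> \<bullet> z - b) / (2 * (norm (c \<omega>) + 1))"] b
      by (auto simp: r_def zero_less_divide_iff add_nonneg_pos)
    have p: "norm (c \<omega>) + 1 > 0" by (simp add: add_nonneg_pos)
    have k2: "2 * (norm (c \<omega>) + 1) * r k < c \<omega> \<bullet> z - b"
      using k p by (simp add: pos_less_divide_eq mult.commute)
    have "norm (c \<omega>) * r k \<le> (norm (c \<omega>) + 1) * r k"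
      using r[of k] by (intro mult_right_mono) auto
    with k2 have k3: "2 * (norm (c \<omega>) * r k) < c \<omega> \<bullet> z - b" by linarith
    obtain q where q: "q \<in> D" "dist q z < r k" using D(2)[OF r] by blast
    have "c \<omega> \<bullet> (z - q) \<le> norm (c \<omega>) * norm (z - q)" by (rule norm_cauchy_schwarz)
    also have "\<dots> \<le> norm (c \<omega>) * r k"
      using q(2) by (intro mult_left_mono) (auto simp: dist_norm norm_minus_commute)
    finally have "b < c \<omega> \<bullet> q - norm (c \<omega>) * r k"
      using k3 by (simp add: inner_diff_right)
    with b(1) have "a < ereal (c \<omega> \<bullet> q - norm (c \<omega>) * r k)"
      using less_trans by force
    moreover have "C \<omega> \<inter> ball q (r k) \<noteq> {}" using q(2) z(1) by auto
    ultimately show "\<exists>q\<in>D. \<exists>k. ?P \<omega> q k" using q(1) by blast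
  next
    assume "\<exists>q\<in>D. \<exists>k. ?P \<omega> q k"
    then obtain q k z where *: "z \<in> C \<omega>" "dist q z < r k" "a < ereal (c \<omega> \<bullet> q - norm (c \<omega>) * r k)"
      by auto
    have "c \<omega> \<bullet> (q - z) \<le> norm (c \<omega>) * norm (q - z)" by (rule norm_cauchy_schwarz)
    also have "\<dots> \<le> norm (c \<omega>) * r k"
      using *(2) by (intro mult_left_mono) (auto simp: dist_norm)
    finally have "ereal (c \<omega> \<bullet> q - norm (c \<omega>) * r k) \<le> ereal (c \<omega> \<bullet> z)"
      by (simp add: inner_diff_right)
    with *(1,3) show "a < (SUP z\<in>C \<omega>. ereal (c \<omega> \<bullet> z))"
      unfolding less_SUP_iff using less_le_trans by blast
  qed
  then have "(\<lambda>\<omega>. SUP z\<in>C \<omega>. ereal (c \<omega> \<bullet> z)) -` {a<..} \<inter> space M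
      = {\<omega>\<in>space M. \<exists>q\<in>D. \<exists>k. ?P \<omega> q k}" by auto
  also have "\<dots> \<in> sets M"
    using C unfolding measurable_set_map_def
    by (intro sets.sets_Collect_countable_Ex' D(1) sets.sets_Collect_countable_Ex sets.sets_Collect_conj) auto
  finally show "(\<lambda>\<omega>. SUP z\<in>C \<omega>. ereal (c \<omega> \<bullet> z)) -` {a<..} \<inter> space M \<in> sets M" .
qed

section \<open>Normal integrands: epigraphs and composition with random vectors\<close>

lemma closed_epi:
  fixes g :: "'b::topological_space \<Rightarrow> ereal"
  assumes "lsc g"
  shows "closed (epi g)"
proof -
  \<comment> \<open>A real number strictly between the height of the point and the value of
    \<open>g\<close> yields an open box outside the epigraph.\<close>
  have "- epi g = (\<Union>a. {x. ereal a < g x} \<times> {..<a})" (is "_ = ?R")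
  proof (intro set_eqI iffI)
    fix z assume "z \<in> - epi g"
    then have "ereal (snd z) < g (fst z)" by (auto simp: epi_def not_le split: prod.splits)
    then obtain a where "ereal (snd z) < ereal a" "ereal a < g (fst z)" using ereal_dense2 by blast
    then show "z \<in> ?R" by (auto simp: mem_Times_iff)
  next
    fix z assume "z \<in> ?R"
    then obtain a where "ereal a < g (fst z)" "snd z < a" by (auto simp: mem_Times_iff)
    then have "ereal (snd z) < g (fst z)" by (metis less_ereal.simps(1) less_trans)
    then show "z \<in> - epi g" by (auto simp: epi_def split: prod.splits)
  qed
  moreover have "open ?R"
    using assms unfolding lsc_def by (intro open_UN ballI open_Times) auto
  ultimately show ?thesis by (simp add: closed_def)
qed

lemma convex_normal_integrandD:
  assumes "convex_normal_integrand M g"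
  shows "measurable_set_map M (\<lambda>\<omega>. epi (\<lambda>x. g x \<omega>))"
    and "\<omega> \<in> space M \<Longrightarrow> closed (epi (\<lambda>x. g x \<omega>))"
  using assms closed_epi unfolding convex_normal_integrand_def measurable_set_map_def closed_fun_def
  by auto

text \<open>The value at \<open>x \<omega>\<close> is at most a real \<open>a\<close> iff two closed
  measurable mappings have a common point: the epigraph and the singleton of
  \<open>(x \<omega>, a)\<close>.\<close>

lemma borel_measurable_normal_integrand:
  assumes g: "convex_normal_integrand M g" and [measurable]: "x \<in> borel_measurable M"
  shows "(\<lambda>\<omega>. g (x \<omega>) \<omega>) \<in> borel_measurable M"
proof -
  have le_real: "{\<omega>\<in>space M. g (x \<omega>) \<omega> \<le> ereal a} \<in> sets M" for a
  proof -
    \<comment> \<open>Indexing the two mappings by \<open>bool\<close> makes them a family to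
      intersect; the whole space as test set then decides nonemptiness.\<close>
    let ?C = "\<lambda>b \<omega>. if b then epi (\<lambda>x. g x \<omega>) else {(x \<omega>, a)}"
    have "measurable_set_map M (?C b)" for b
      using convex_normal_integrandD(1)[OF g]
        measurable_set_map_singleton[where g = "\<lambda>\<omega>. (x \<omega>, a)" and M = M] by (cases b) auto
    moreover have "closed (?C b \<omega>)" if "\<omega> \<in> space M" for b \<omega>
      using convex_normal_integrandD(2)[OF g that] by auto
    ultimately have "measurable_set_map M (\<lambda>\<omega>. \<Inter>b\<in>UNIV. ?C b \<omega>)"
      by (intro measurable_set_map_INT) auto
    then have "{\<omega>\<in>space M. (\<Inter>b\<in>UNIV. ?C b \<omega>) \<inter> UNIV \<noteq> {}} \<in> sets M"
      unfolding measurable_set_map_def by blast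
    also have "{\<omega>\<in>space M. (\<Inter>b\<in>UNIV. ?C b \<omega>) \<inter> UNIV \<noteq> {}} = {\<omega>\<in>space M. g (x \<omega>) \<omega> \<le> ereal a}"
      by (auto simp: epi_def UNIV_bool)
    finally show ?thesis .
  qed
  show ?thesis
    unfolding borel_measurable_iff_Iic_ereal
  proof
    fix a :: ereal
    have eq: "(\<lambda>\<omega>. g (x \<omega>) \<omega>) -` {..a} \<inter> space M = {\<omega>\<in>space M. g (x \<omega>) \<omega> \<le> a}" by auto
    show "(\<lambda>\<omega>. g (x \<omega>) \<omega>) -` {..a} \<inter> space M \<in> sets M"
    proof (cases a)
      case (real b)
      then show ?thesis using le_real[of b] eq by simp
    next
      case PInf
      then show ?thesis unfolding eq by simp
    next
      case MInf
      \<comment> \<open>The level \<open>-\<infinity>\<close> is not the height of a point of an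
        epigraph; it is reached as the countable intersection of the levels
        \<open>- real n\<close>.\<close>
      have "s = -\<infinity>" if "\<forall>n. s \<le> ereal (- real n)" for s :: ereal
      proof (rule ereal_bot)
        fix B :: real
        obtain n where "- B < real n" using reals_Archimedean2 by blast
        then have "ereal (- real n) \<le> ereal B" by simp
        then show "s \<le> ereal B" using that order_trans by blast
      qed
      then have "{\<omega>\<in>space M. g (x \<omega>) \<omega> \<le> a} = {\<omega>\<in>space M. \<forall>n. g (x \<omega>) \<omega> \<le> ereal (- real n)}"
        using MInf by auto
      also have "\<dots> \<in> sets M"
        using le_real by (intro sets.sets_Collect_countable_All)
      finally show ?thesis using eq by simp
    qed
  qed
qed

section \<open>Orthogonality of adapted processes to the annihilator\<close>

text \<open>\<open>S\<close> is bounded from above only, but \<open>h - S\<close> is nonnegative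
  a.e., its truncations increase, and their integrals converge because those of \<open>S\<close>
  agree with those of the integrable \<open>S'\<close>. Monotone convergence makes \<open>S\<close>
  integrable; dominated convergence then identifies the integrals.\<close>

lemma integrable_dominated_bounded_exhaustion:
  fixes h S S' :: "'a \<Rightarrow> real"
  assumes A: "\<And>n. A n \<in> sets M" "incseq A" "(\<Union>n. A n) = space M"
    and [measurable]: "S \<in> borel_measurable M"
    and h: "integrable M h" and le: "AE \<omega> in M. S \<omega> \<le> h \<omega>"
    and S': "integrable M S'"
    and int: "\<And>n. integrable M (\<lambda>\<omega>. indicator (A n) \<omega> * S \<omega>)"
    and eq: "\<And>n. (\<integral>\<omega>. indicator (A n) \<omega> * S \<omega> \<partial>M) = (\<integral>\<omega>. indicator (A n) \<omega> * S' \<omega> \<partial>M)"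
  shows "integrable M S" "(\<integral>\<omega>. S \<omega> \<partial>M) = (\<integral>\<omega>. S' \<omega> \<partial>M)"
proof -
  note [measurable] = A(1)
  have [measurable]: "h \<in> borel_measurable M" "S' \<in> borel_measurable M"
    using h S' by auto
  have one: "(\<lambda>n. indicator (A n) \<omega> * c) \<longlonglongrightarrow> c" if "\<omega> \<in> space M" for \<omega> and c :: real
    using tendsto_mult_right[OF LIMSEQ_indicator_incseq[OF A(2), of \<omega>], of c] that A(3) by simp
  have lim: "(\<lambda>n. \<integral>\<omega>. indicator (A n) \<omega> * g \<omega> \<partial>M) \<longlonglongrightarrow> (\<integral>\<omega>. g \<omega> \<partial>M)"
    if g: "integrable M g" for g :: "'a \<Rightarrow> real"
  proof (rule integral_dominated_convergence[where w = "\<lambda>\<omega>. norm (g \<omega>)"])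
    show "AE \<omega> in M. (\<lambda>n. indicator (A n) \<omega> * g \<omega>) \<longlonglongrightarrow> g \<omega>"
      using one by (intro AE_I2)
  qed (use g in \<open>auto simp: indicator_def\<close>)
  let ?f = "\<lambda>n \<omega>. indicator (A n) \<omega> * (h \<omega> - S \<omega>)"
  have hA: "integrable M (\<lambda>\<omega>. indicator (A n) \<omega> * h \<omega>)" for n
    using integrable_mult_indicator[OF A(1) h] by simp
  have intf: "integrable M (?f n)" for n
    using Bochner_Integration.integrable_diff[OF hA int, of n n] by (simp add: right_diff_distrib)
  have "(\<integral>\<omega>. ?f n \<omega> \<partial>M) = (\<integral>\<omega>. indicator (A n) \<omega> * h \<omega> \<partial>M) - (\<integral>\<omega>. indicator (A n) \<omega> * S' \<omega> \<partial>M)" for n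
    using Bochner_Integration.integral_diff[OF hA int, of n n] eq[of n] by (simp add: right_diff_distrib)
  then have limf: "(\<lambda>n. \<integral>\<omega>. ?f n \<omega> \<partial>M) \<longlonglongrightarrow> (\<integral>\<omega>. h \<omega> \<partial>M) - (\<integral>\<omega>. S' \<omega> \<partial>M)"
    using tendsto_diff[OF lim[OF h] lim[OF S']] by simp
  have mono: "AE \<omega> in M. mono (\<lambda>n. ?f n \<omega>)"
    using le
  proof eventually_elim
    case (elim \<omega>)
    have "indicator (A m) \<omega> \<le> (indicator (A n) \<omega> :: real)" if "m \<le> n" for m n
      using incseqD[OF A(2) that] by (auto simp: indicator_def)
    with elim show ?case by (intro monoI mult_right_mono) auto
  qed
  have conv: "AE \<omega> in M. (\<lambda>n. ?f n \<omega>) \<longlonglongrightarrow> h \<omega> - S \<omega>"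
    using one by (intro AE_I2)
  have "integrable M (\<lambda>\<omega>. h \<omega> - S \<omega>)"
    by (rule integrable_monotone_convergence[OF intf mono conv limf]) simp
  then show S: "integrable M S"
    using Bochner_Integration.integrable_diff[OF h, of "\<lambda>\<omega>. h \<omega> - S \<omega>"] by simp
  show "(\<integral>\<omega>. S \<omega> \<partial>M) = (\<integral>\<omega>. S' \<omega> \<partial>M)"
    using LIMSEQ_unique[OF lim[OF S]] lim[OF S'] eq by simp
qed

text \<open>The summands \<open>x i * v i\<close> need not be integrable: an upper bound of the sum suffices.\<close>

lemma integral_adapted_orthogonal_sum_eq_0:
  fixes M :: "'a measure" and F :: "nat \<Rightarrow> 'a measure" and \<tau> :: "'i \<Rightarrow> nat"
    and x v :: "'i \<Rightarrow> 'a \<Rightarrow> real"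
  assumes "prob_space M" and "finite I"
    and sub: "\<And>t. t < k \<Longrightarrow> subalgebra M (F t)"
    and mono: "\<And>s t. s \<le> t \<Longrightarrow> t < k \<Longrightarrow> sets (F s) \<subseteq> sets (F t)"
    and \<tau>: "\<And>i. i \<in> I \<Longrightarrow> \<tau> i < k"
    and x: "\<And>i. i \<in> I \<Longrightarrow> x i \<in> borel_measurable (F (\<tau> i))"
    and v: "\<And>i. i \<in> I \<Longrightarrow> integrable M (v i)"
    and orth: "\<And>i z C. i \<in> I \<Longrightarrow> z \<in> borel_measurable (F (\<tau> i)) \<Longrightarrow> (\<And>\<omega>. \<bar>z \<omega>\<bar> \<le> C) \<Longrightarrow>
      (\<integral>\<omega>. z \<omega> * v i \<omega> \<partial>M) = 0"
    and h: "integrable M h" and le: "AE \<omega> in M. (\<Sum>i\<in>I. x i \<omega> * v i \<omega>) \<le> h \<omega>"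
  shows "integrable M (\<lambda>\<omega>. \<Sum>i\<in>I. x i \<omega> * v i \<omega>) \<and> (\<integral>\<omega>. (\<Sum>i\<in>I. x i \<omega> * v i \<omega>) \<partial>M) = 0"
  using assms(2-)
proof (induction k arbitrary: I v h)
  case 0
  then have "I = {}" by blast
  then show ?case by simp
next
  case (Suc k)
  interpret prob_space M by fact
  note fin = \<open>finite I\<close>
  let ?G = "F k"
  have G: "subalgebra M ?G" using Suc.prems by simp
  interpret G: sigma_finite_subalgebra M ?G
    by (rule finite_measure_subalgebra_is_sigma_finite) (use G in \<open>unfold_locales\<close>)
  \<comment> \<open>Conditioning on the last sigma-algebra produces the data \<open>?w\<close> and
    \<open>?h\<close> for the induction hypothesis, which is why \<open>v\<close> and
    \<open>h\<close> are arbitrary in the induction.\<close>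
  let ?w = "\<lambda>i. real_cond_exp M ?G (v i)"
  let ?h = "real_cond_exp M ?G h"
  define S where "S \<omega> = (\<Sum>i\<in>I. x i \<omega> * v i \<omega>)" for \<omega>
  define S' where "S' \<omega> = (\<Sum>i\<in>I. x i \<omega> * ?w i \<omega>)" for \<omega>
  \<comment> \<open>The indices of the earlier stages. The others, with \<open>\<tau> i = k\<close>,
    drop out because their \<open>?w i\<close> vanishes a.e.\<close>
  define J where "J = {i\<in>I. \<tau> i < k}"
  have spF: "space (F t) = space M" if "t \<le> k" for t
    using Suc.prems(2)[of t] that by (simp add: subalgebra_def)
  have meas_G: "z \<in> borel_measurable ?G" if "t \<le> k" "z \<in> borel_measurable (F t)" for t and z :: "'a \<Rightarrow> real"
    using that Suc.prems(3)[of t k] spF[of t] spF[of k] unfolding measurable_def by auto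
  have meas_M: "z \<in> borel_measurable M" if "z \<in> borel_measurable ?G" for z :: "'a \<Rightarrow> real"
    using measurable_from_subalg[OF G that] .
  have xG [measurable]: "x i \<in> borel_measurable ?G" if "i \<in> I" for i
    using meas_G[of "\<tau> i"] Suc.prems(4,5) that by force
  have xM [measurable]: "x i \<in> borel_measurable M" if "i \<in> I" for i
    using meas_M xG that by blast
  have vM [measurable]: "v i \<in> borel_measurable M" if "i \<in> I" for i
    using Suc.prems(6) that by auto
  have intbd: "integrable M (\<lambda>\<omega>. z \<omega> * g \<omega>)"
    if "z \<in> borel_measurable M" "\<And>\<omega>. \<bar>z \<omega>\<bar> \<le> C" "integrable M g" for z g :: "'a \<Rightarrow> real" and C
  proof (rule Bochner_Integration.integrable_bound)
    show "integrable M (\<lambda>\<omega>. C * g \<omega>)" using that(3) by simp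
    show "(\<lambda>\<omega>. z \<omega> * g \<omega>) \<in> borel_measurable M"
      using that(1) borel_measurable_integrable[OF that(3)] by (rule borel_measurable_times)
    have "norm (z \<omega> * g \<omega>) \<le> norm (C * g \<omega>)" for \<omega>
      unfolding real_norm_def abs_mult using that(2)[of \<omega>] by (intro mult_right_mono) linarith+
    then show "AE \<omega> in M. norm (z \<omega> * g \<omega>) \<le> norm (C * g \<omega>)" by simp
  qed
  have proj: "(\<integral>\<omega>. z \<omega> * ?w i \<omega> \<partial>M) = (\<integral>\<omega>. z \<omega> * v i \<omega> \<partial>M)"
    if "i \<in> I" "z \<in> borel_measurable ?G" "\<And>\<omega>. \<bar>z \<omega>\<bar> \<le> C" for i z C
    by (rule G.real_cond_exp_intg(2)[OF intbd[OF meas_M[OF that(2)] that(3) Suc.prems(6)[OF that(1)]]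
          that(2) vM[OF that(1)]])
  \<comment> \<open>Every \<open>x i\<close> is measurable for \<open>?G\<close>, so these sets lie
    in \<open>?G\<close> and their indicators pass through the conditional expectation. Truncated to
    \<open>A n\<close>, all products are integrable.\<close>
  define A where "A n = {\<omega>\<in>space M. \<forall>i\<in>I. \<bar>x i \<omega>\<bar> \<le> real n}" for n
  have AG [measurable]: "A n \<in> sets ?G" for n
  proof -
    have "{\<omega>\<in>space ?G. \<forall>i\<in>I. \<bar>x i \<omega>\<bar> \<le> real n} \<in> sets ?G"
      using xG by (intro sets.sets_Collect_finite_All fin borel_measurable_le borel_measurable_abs) auto
    then show ?thesis by (simp only: A_def spF[OF order_refl])
  qed
  have AM [measurable]: "A n \<in> sets M" for n
    using AG G by (auto simp: subalgebra_def)
  have incA: "incseq A"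
    unfolding A_def incseq_def by (auto intro: order_trans)
  have UA: "(\<Union>n. A n) = space M"
  proof -
    have "\<exists>n. \<forall>i\<in>I. \<bar>x i \<omega>\<bar> \<le> real n" for \<omega>
    proof -
      obtain n where "(\<Sum>i\<in>I. \<bar>x i \<omega>\<bar>) \<le> real n" using real_arch_simple by blast
      then have "\<forall>i\<in>I. \<bar>x i \<omega>\<bar> \<le> real n"
        using member_le_sum[of _ I "\<lambda>i. \<bar>x i \<omega>\<bar>"] fin by fastforce
      then show ?thesis ..
    qed
    then show ?thesis by (auto simp: A_def)
  qed
  let ?a = "\<lambda>n i \<omega>. indicator (A n) \<omega> * x i \<omega>"
  have a_bd: "\<bar>?a n i \<omega>\<bar> \<le> real n" if "i \<in> I" for n i \<omega>
    using that by (auto simp: A_def indicator_def)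
  have aG [measurable]: "?a n i \<in> borel_measurable ?G" if "i \<in> I" for n i
    by (rule borel_measurable_times[OF borel_measurable_indicator[OF AG] xG[OF that]])
  have inta: "integrable M (\<lambda>\<omega>. ?a n i \<omega> * v i \<omega>)" if "i \<in> I" for n i
    by (rule intbd[OF meas_M[OF aG[OF that]] a_bd[OF that] Suc.prems(6)[OF that]])
  have intaw: "integrable M (\<lambda>\<omega>. ?a n i \<omega> * ?w i \<omega>)" if "i \<in> I" for n i
    by (rule intbd[OF meas_M[OF aG[OF that]] a_bd[OF that]
          G.real_cond_exp_int(1)[OF Suc.prems(6)[OF that]]])
  have AS: "indicator (A n) \<omega> * S \<omega> = (\<Sum>i\<in>I. ?a n i \<omega> * v i \<omega>)" for n \<omega>
    by (simp add: S_def sum_distrib_left mult.assoc)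
  have AS': "indicator (A n) \<omega> * S' \<omega> = (\<Sum>i\<in>I. ?a n i \<omega> * ?w i \<omega>)" for n \<omega>
    by (simp add: S'_def sum_distrib_left mult.assoc)
  have ASint: "integrable M (\<lambda>\<omega>. indicator (A n) \<omega> * S \<omega>)" for n
    unfolding AS using inta by (intro Bochner_Integration.integrable_sum)
  have ASeq: "(\<integral>\<omega>. indicator (A n) \<omega> * S \<omega> \<partial>M) = (\<integral>\<omega>. indicator (A n) \<omega> * S' \<omega> \<partial>M)" for n
    unfolding AS AS' using inta intaw proj[OF _ aG a_bd] by (simp add: Bochner_Integration.integral_sum)
  \<comment> \<open>At the last stage, orthogonality to the indicators of sets in \<open>?G\<close>,
    which are bounded by 1, says that the conditional expectation is zero.\<close>
  have w0: "AE \<omega> in M. ?w i \<omega> = 0" if i: "i \<in> I" "\<tau> i = k" for i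
  proof -
    have "AE \<omega> in M. real_cond_exp M ?G (v i) \<omega> = (\<lambda>_. 0) \<omega>"
    proof (rule G.real_cond_exp_charact)
      fix B assume "B \<in> sets ?G"
      then have "(\<integral>\<omega>. indicator B \<omega> * v i \<omega> \<partial>M) = 0"
        using i by (intro Suc.prems(7)[of i _ 1]) (auto simp: indicator_def)
      then show "(\<integral>\<omega>\<in>B. v i \<omega> \<partial>M) = (\<integral>\<omega>\<in>B. 0 \<partial>M)" by (simp add: set_lebesgue_integral_def)
    qed (use Suc.prems(6) i in auto)
    then show ?thesis by simp
  qed
  have S'J: "AE \<omega> in M. S' \<omega> = (\<Sum>i\<in>J. x i \<omega> * ?w i \<omega>)"
  proof -
    have "AE \<omega> in M. \<forall>i\<in>I - J. ?w i \<omega> = 0"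
      using fin Suc.prems(4) by (intro AE_finite_allI w0) (auto simp: J_def less_Suc_eq)
    then show ?thesis
      unfolding S'_def
      by eventually_elim (rule sum.mono_neutral_right, use fin in \<open>auto simp: J_def\<close>)
  qed
  \<comment> \<open>\<open>S\<close> is not yet known to be integrable, so the bound is conditioned
    after truncation to \<open>A n\<close>, where conditioning \<open>S\<close> gives
    \<open>S'\<close>. The sets \<open>A n\<close> exhaust the space.\<close>
  have le': "AE \<omega> in M. S' \<omega> \<le> ?h \<omega>"
  proof -
    have "AE \<omega> in M. indicator (A n) \<omega> * S' \<omega> \<le> indicator (A n) \<omega> * ?h \<omega>" for n
    proof -
      have intAh: "integrable M (\<lambda>\<omega>. indicator (A n) \<omega> * h \<omega>)"
        using integrable_mult_indicator[OF AM Suc.prems(8)] by simp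
      have "AE \<omega> in M. real_cond_exp M ?G (\<lambda>\<omega>. indicator (A n) \<omega> * S \<omega>) \<omega>
          \<le> real_cond_exp M ?G (\<lambda>\<omega>. indicator (A n) \<omega> * h \<omega>) \<omega>"
        using Suc.prems(9) ASint intAh
        by (intro G.real_cond_exp_mono) (auto simp: S_def indicator_def elim!: eventually_mono)
      moreover have "AE \<omega> in M. real_cond_exp M ?G (\<lambda>\<omega>. indicator (A n) \<omega> * h \<omega>) \<omega> = indicator (A n) \<omega> * ?h \<omega>"
        using Suc.prems(8) intAh by (intro G.real_cond_exp_mult) auto
      moreover have "AE \<omega> in M. real_cond_exp M ?G (\<lambda>\<omega>. indicator (A n) \<omega> * S \<omega>) \<omega>
          = indicator (A n) \<omega> * S' \<omega>"
      proof (rule G.real_cond_exp_charact)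
        fix B assume B: "B \<in> sets ?G"
        have BM: "B \<in> sets M" using B G by (auto simp: subalgebra_def)
        \<comment> \<open>The indicator of \<open>B\<close> keeps the truncated factor bounded and
          \<open>?G\<close>-measurable, so \<open>proj\<close> applies to each summand.\<close>
        have bd: "\<bar>indicator B \<omega> * ?a n i \<omega>\<bar> \<le> real n" if "i \<in> I" for i \<omega>
          using a_bd[OF that, of n \<omega>] by (auto simp: indicator_def)
        have "integrable M (\<lambda>\<omega>. indicator B \<omega> * (?a n i \<omega> * v i \<omega>))"
          "integrable M (\<lambda>\<omega>. indicator B \<omega> * (?a n i \<omega> * ?w i \<omega>))"
          "(\<integral>\<omega>. indicator B \<omega> * (?a n i \<omega> * v i \<omega>) \<partial>M) = (\<integral>\<omega>. indicator B \<omega> * (?a n i \<omega> * ?w i \<omega>) \<partial>M)"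
          if i: "i \<in> I" for i
          using integrable_mult_indicator[OF BM inta[OF i, of n]]
            integrable_mult_indicator[OF BM intaw[OF i, of n]]
            proj[OF i _ bd[OF i]] B aG[OF i]
          by (auto simp: mult.assoc)
        then show "(\<integral>\<omega>\<in>B. indicator (A n) \<omega> * S \<omega> \<partial>M) = (\<integral>\<omega>\<in>B. indicator (A n) \<omega> * S' \<omega> \<partial>M)"
          unfolding AS AS' set_lebesgue_integral_def
          by (simp add: sum_distrib_left Bochner_Integration.integral_sum)
      next
        show "integrable M (\<lambda>\<omega>. indicator (A n) \<omega> * S' \<omega>)"
          unfolding AS' using intaw by (intro Bochner_Integration.integrable_sum)
        show "(\<lambda>\<omega>. indicator (A n) \<omega> * S' \<omega>) \<in> borel_measurable ?G"
          unfolding AS' by measurable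
      qed (rule ASint)
      ultimately show ?thesis by eventually_elim simp
    qed
    then have "AE \<omega> in M. \<forall>n. indicator (A n) \<omega> * S' \<omega> \<le> indicator (A n) \<omega> * ?h \<omega>"
      by (simp add: AE_all_countable)
    with AE_space show ?thesis
    proof eventually_elim
      case (elim \<omega>)
      then obtain n where "\<omega> \<in> A n" using UA by blast
      with elim(2) show ?case by (auto dest: spec[of _ n])
    qed
  qed
  have "integrable M (\<lambda>\<omega>. \<Sum>i\<in>J. x i \<omega> * ?w i \<omega>) \<and> (\<integral>\<omega>. (\<Sum>i\<in>J. x i \<omega> * ?w i \<omega>) \<partial>M) = 0"
  proof (rule Suc.IH[where h = ?h])
    show "AE \<omega> in M. (\<Sum>i\<in>J. x i \<omega> * ?w i \<omega>) \<le> ?h \<omega>"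
      using S'J le' by eventually_elim simp
  next
    fix i z and C :: real
    assume *: "i \<in> J" "z \<in> borel_measurable (F (\<tau> i))" "\<And>\<omega>. \<bar>z \<omega>\<bar> \<le> C"
    then have i: "i \<in> I" "\<tau> i < k" by (auto simp: J_def)
    \<comment> \<open>At an earlier stage \<open>z\<close> is measurable for \<open>?G\<close> as
      well, so the conditioning can be undone under the integral.\<close>
    have "(\<integral>\<omega>. z \<omega> * ?w i \<omega> \<partial>M) = (\<integral>\<omega>. z \<omega> * v i \<omega> \<partial>M)"
      using i meas_G[OF _ *(2)] *(3) by (intro proj) auto
    also have "\<dots> = 0"
      using i(1) *(2,3) by (rule Suc.prems(7))
    finally show "(\<integral>\<omega>. z \<omega> * ?w i \<omega> \<partial>M) = 0" .
  qed (use fin Suc.prems J_def in auto)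
  moreover have "(\<lambda>\<omega>. \<Sum>i\<in>J. x i \<omega> * ?w i \<omega>) \<in> borel_measurable M"
    using calculation by blast
  moreover have S'M: "S' \<in> borel_measurable M"
    unfolding S'_def[abs_def] by measurable
  ultimately have S': "integrable M S'" "(\<integral>\<omega>. S' \<omega> \<partial>M) = 0"
    using integrable_cong_AE[OF _ _ S'J] integral_cong_AE[OF _ _ S'J] by auto
  have SM: "S \<in> borel_measurable M"
    unfolding S_def[abs_def] by measurable
  have leS: "AE \<omega> in M. S \<omega> \<le> h \<omega>"
    using Suc.prems(9) by (simp add: S_def)
  \<comment> \<open>\<open>S'\<close> agrees a.e. with the sum over \<open>J\<close> and so has
    integral zero; the equal truncated integrals carry this over to \<open>S\<close>.\<close>
  show ?case
    using integrable_dominated_bounded_exhaustion[OF AM incA UA SM Suc.prems(8) leS S'(1) ASint ASeq] S'(2)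
    by (simp add: S_def[abs_def])
qed

text \<open>Decomposability along the empty set replaces the zero element by any bounded
  one.\<close>

lemma L_infty_subset:
  fixes X :: "('a \<Rightarrow> real^'k) set"
  assumes "linear_rv_space M X" "decomposable M X"
  shows "L_infty M \<subseteq> X"
proof
  fix w :: "'a \<Rightarrow> real^'k" assume "w \<in> L_infty M"
  moreover have "(\<lambda>\<omega>. 0) \<in> X" using assms(1) by (simp add: linear_rv_space_def)
  ultimately show "w \<in> X"
    using assms(2)[unfolded decomposable_def, rule_format, of "\<lambda>\<omega>. 0" w "{}"] by simp
qed

text \<open>Bounded adapted processes belong to \<open>X\<close>, and testing \<open>p\<close> with
  those living in one coordinate gives the scalar orthogonality relations. The bound
  \<open>h\<close> stands in for membership of \<open>x\<close> in \<open>X\<close>.\<close>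

lemma adapted_inner_annihilator:
  fixes M :: "'a measure" and F :: "nat \<Rightarrow> 'a measure" and \<tau> :: "'n::finite \<Rightarrow> nat"
    and X V :: "('a \<Rightarrow> real^'n) set"
  assumes "prob_space M"
    and sub: "\<And>t. t \<le> T \<Longrightarrow> subalgebra M (F t)"
    and mono: "\<And>s t. s \<le> t \<Longrightarrow> t \<le> T \<Longrightarrow> sets (F s) \<subseteq> sets (F t)"
    and \<tau>: "\<And>i. \<tau> i \<le> T"
    and dual: "dual_pair M X V"
    and x: "x \<in> adapted_space M F \<tau>"
    and p: "p \<in> annihilator M V (X \<inter> adapted_space M F \<tau>)"
    and h: "integrable M h" and le: "AE \<omega> in M. x \<omega> \<bullet> p \<omega> \<le> h \<omega>"
  shows "integrable M (\<lambda>\<omega>. x \<omega> \<bullet> p \<omega>)" "(\<integral>\<omega>. x \<omega> \<bullet> p \<omega> \<partial>M) = 0"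
proof -
  interpret prob_space M by fact
  have LX: "L_infty M \<subseteq> X"
    using dual L_infty_subset unfolding dual_pair_def by blast
  have pV: "p \<in> V" and ann: "\<And>w. w \<in> X \<Longrightarrow> w \<in> adapted_space M F \<tau> \<Longrightarrow> pairing M w p = 0"
    using p by (auto simp: annihilator_def)
  have [measurable]: "p \<in> borel_measurable M" "x \<in> borel_measurable M"
    using pV dual x by (auto simp: dual_pair_def linear_rv_space_def adapted_space_def)
  have pint: "integrable M (\<lambda>\<omega>. p \<omega> $ i)" for i
  proof -
    \<comment> \<open>Pairing \<open>p\<close> with a constant unit vector isolates one coordinate
      and shows it integrable.\<close>
    have "(\<lambda>\<omega>. axis i 1) \<in> L_infty M" by (auto simp: L_infty_def)
    then have "(\<lambda>\<omega>. axis i 1) \<in> X" using LX by blast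
    then have "integrable M (\<lambda>\<omega>. axis i 1 \<bullet> p \<omega>)"
      using dual pV unfolding dual_pair_def separating_duality_def by fast
    then show ?thesis by (simp add: inner_axis')
  qed
  have orth: "(\<integral>\<omega>. z \<omega> * p \<omega> $ i \<partial>M) = 0"
    if z: "z \<in> borel_measurable (F (\<tau> i))" "\<And>\<omega>. \<bar>z \<omega>\<bar> \<le> C" for i z C
  proof -
    have zM [measurable]: "z \<in> borel_measurable M"
      using measurable_from_subalg[OF sub[OF \<tau>] z(1)] .
    let ?w = "\<lambda>\<omega>. z \<omega> *\<^sub>R axis i (1::real)"
    have "?w \<in> L_infty M" using z(2) by (auto simp: L_infty_def)
    then have "?w \<in> X" using LX by blast
    moreover have "?w \<in> adapted_space M F \<tau>"
      unfolding adapted_space_def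
    proof (intro CollectI conjI allI)
      fix j
      show "\<exists>z'\<in>borel_measurable (F (\<tau> j)). AE \<omega> in M. ?w \<omega> $ j = z' \<omega>"
        using z(1) by (intro bexI[of _ "if j = i then z else (\<lambda>_. 0)"]) (auto simp: axis_def)
    qed measurable
    ultimately have "pairing M ?w p = 0" by (rule ann)
    then show ?thesis by (simp add: pairing_def inner_axis')
  qed
  \<comment> \<open>Adaptedness holds up to null sets only, so each coordinate is replaced by a
    version that is exactly measurable for its stage.\<close>
  obtain Z where Z: "\<And>i. Z i \<in> borel_measurable (F (\<tau> i))" "\<And>i. AE \<omega> in M. x \<omega> $ i = Z i \<omega>"
    using x unfolding adapted_space_def by simp metis
  have ZM [measurable]: "Z i \<in> borel_measurable M" for i
    using measurable_from_subalg[OF sub[OF \<tau>] Z(1)] .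
  have eq: "AE \<omega> in M. x \<omega> \<bullet> p \<omega> = (\<Sum>i\<in>UNIV. Z i \<omega> * p \<omega> $ i)"
  proof -
    have "AE \<omega> in M. \<forall>i\<in>UNIV. x \<omega> $ i = Z i \<omega>"
      using Z(2) by (intro AE_finite_allI) auto
    then show ?thesis by eventually_elim (simp add: inner_vec_def)
  qed
  have "integrable M (\<lambda>\<omega>. \<Sum>i\<in>UNIV. Z i \<omega> * p \<omega> $ i) \<and> (\<integral>\<omega>. (\<Sum>i\<in>UNIV. Z i \<omega> * p \<omega> $ i) \<partial>M) = 0"
  \<comment> \<open>The stages are \<open>0, ..., T\<close>, hence \<open>Suc T\<close> of
    them.\<close>
  proof (rule integral_adapted_orthogonal_sum_eq_0[where k = "Suc T" and \<tau> = \<tau> and F = F])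
    show "AE \<omega> in M. (\<Sum>i\<in>UNIV. Z i \<omega> * p \<omega> $ i) \<le> h \<omega>"
      using eq le by eventually_elim simp
    show "(\<integral>\<omega>. z \<omega> * p \<omega> $ i \<partial>M) = 0"
      if "z \<in> borel_measurable (F (\<tau> i))" "\<And>\<omega>. \<bar>z \<omega>\<bar> \<le> C" for i z C
      using that by (rule orth)
  qed (use sub mono \<tau> Z(1) pint h in \<open>auto simp: less_Suc_eq_le prob_space_axioms\<close>)
  then show "integrable M (\<lambda>\<omega>. x \<omega> \<bullet> p \<omega>)" "(\<integral>\<omega>. x \<omega> \<bullet> p \<omega> \<partial>M) = 0"
    using integrable_cong_AE[OF _ _ eq] integral_cong_AE[OF _ _ eq] by auto
qed

section \<open>Extended expectations and integrable bounds\<close>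

lemma ext_expectation_cong_AE:
  assumes "AE \<omega> in M. \<phi> \<omega> = \<psi> \<omega>"
  shows "ext_expectation M \<phi> = ext_expectation M \<psi>"
proof -
  have "(\<integral>\<^sup>+\<omega>. e2ennreal (\<phi> \<omega>) \<partial>M) = (\<integral>\<^sup>+\<omega>. e2ennreal (\<psi> \<omega>) \<partial>M)"
    "(\<integral>\<^sup>+\<omega>. e2ennreal (- \<phi> \<omega>) \<partial>M) = (\<integral>\<^sup>+\<omega>. e2ennreal (- \<psi> \<omega>) \<partial>M)"
    using assms by (auto intro!: nn_integral_cong_AE elim!: eventually_mono)
  then show ?thesis by (simp add: ext_expectation_def)
qed

lemma ext_expectation_eq_integral:
  assumes g: "integrable M g" and eq: "AE \<omega> in M. \<phi> \<omega> = ereal (g \<omega>)"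
  shows "ext_expectation M \<phi> = ereal (\<integral>\<omega>. g \<omega> \<partial>M)"
proof -
  have pos: "(\<integral>\<^sup>+\<omega>. e2ennreal (\<phi> \<omega>) \<partial>M) = (\<integral>\<^sup>+\<omega>. ennreal (g \<omega>) \<partial>M)"
    using eq by (intro nn_integral_cong_AE) (auto elim!: eventually_mono)
  have neg: "(\<integral>\<^sup>+\<omega>. e2ennreal (- \<phi> \<omega>) \<partial>M) = (\<integral>\<^sup>+\<omega>. ennreal (- g \<omega>) \<partial>M)"
    using eq by (intro nn_integral_cong_AE) (auto elim!: eventually_mono)
  have fin: "(\<integral>\<^sup>+\<omega>. ennreal (g \<omega>) \<partial>M) \<noteq> \<infinity>" "(\<integral>\<^sup>+\<omega>. ennreal (- g \<omega>) \<partial>M) \<noteq> \<infinity>"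
    using g unfolding real_integrable_def by auto
  have e: "enn2ereal a = ereal (enn2real a)" if "a \<noteq> \<infinity>" for a
    using that by (cases a) auto
  show ?thesis
    unfolding ext_expectation_def pos neg real_lebesgue_integral_def[OF g] using fin by (simp add: e)
qed

text \<open>The extended expectation is \<open>\<infinity>\<close> unless the positive part has a
  finite integral; the real version of the positive part then serves as \<open>h\<close>.\<close>

lemma ext_expectation_less_top_upper_bound:
  assumes [measurable]: "\<phi> \<in> borel_measurable M" and "ext_expectation M \<phi> < \<infinity>"
  obtains h where "integrable M h" "AE \<omega> in M. \<phi> \<omega> \<le> ereal (h \<omega>)"
proof
  have fin: "(\<integral>\<^sup>+\<omega>. e2ennreal (\<phi> \<omega>) \<partial>M) \<noteq> \<infinity>"
    using assms(2) unfolding ext_expectation_def by (auto split: if_splits)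
  have meas: "(\<lambda>\<omega>. e2ennreal (\<phi> \<omega>)) \<in> borel_measurable M" by measurable
  have AE: "AE \<omega> in M. e2ennreal (\<phi> \<omega>) \<noteq> \<infinity>"
    using nn_integral_PInf_AE[OF meas fin] .
  show "AE \<omega> in M. \<phi> \<omega> \<le> ereal (enn2real (e2ennreal (\<phi> \<omega>)))"
    using AE
  proof eventually_elim
    case (elim \<omega>)
    then show ?case
    proof (cases "\<phi> \<omega>")
      case (real r)
      then show ?thesis by (cases "r \<ge> 0") (auto simp: ennreal_neg)
    qed auto
  qed
  have "(\<integral>\<^sup>+\<omega>. ennreal (enn2real (e2ennreal (\<phi> \<omega>))) \<partial>M) = (\<integral>\<^sup>+\<omega>. e2ennreal (\<phi> \<omega>) \<partial>M)"
    using AE by (intro nn_integral_cong_AE) (auto elim!: eventually_mono simp: less_top)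
  then show "integrable M (\<lambda>\<omega>. enn2real (e2ennreal (\<phi> \<omega>)))"
    using fin by (intro integrableI_nonneg) (auto simp: less_top)
qed

text \<open>The two bounds make \<open>\<phi>\<close> finite a.e., so \<open>real_of_ereal\<close>
  falls back on its default 0 at infinite values only on a null set; the sum of the absolute values
  of the bounds dominates it.\<close>

lemma integrable_version_between:
  assumes [measurable]: "\<phi> \<in> borel_measurable M" and r: "integrable M r" and h: "integrable M h"
    and le: "AE \<omega> in M. ereal (r \<omega>) \<le> \<phi> \<omega>" "AE \<omega> in M. \<phi> \<omega> \<le> ereal (h \<omega>)"
  shows "integrable M (\<lambda>\<omega>. real_of_ereal (\<phi> \<omega>))"
    and "AE \<omega> in M. \<phi> \<omega> = ereal (real_of_ereal (\<phi> \<omega>))"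
proof -
  show eq: "AE \<omega> in M. \<phi> \<omega> = ereal (real_of_ereal (\<phi> \<omega>))"
    using le
  proof eventually_elim
    case (elim \<omega>)
    then show ?case by (cases "\<phi> \<omega>") auto
  qed
  have "integrable M (\<lambda>\<omega>. \<bar>r \<omega>\<bar> + \<bar>h \<omega>\<bar>)" using r h by auto
  then show "integrable M (\<lambda>\<omega>. real_of_ereal (\<phi> \<omega>))"
  proof (rule Bochner_Integration.integrable_bound)
    show "AE \<omega> in M. norm (real_of_ereal (\<phi> \<omega>)) \<le> norm (\<bar>r \<omega>\<bar> + \<bar>h \<omega>\<bar>)"
      using le eq
    proof eventually_elim
      case (elim \<omega>)
      then have "r \<omega> \<le> real_of_ereal (\<phi> \<omega>)" "real_of_ereal (\<phi> \<omega>) \<le> h \<omega>"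
        by (metis ereal_less_eq(3))+
      then show ?case unfolding real_norm_def by linarith
    qed
  qed measurable
qed

section \<open>Graphs of affine integrands as measurable mappings\<close>

lemma measurable_set_map_affine_graph:
  fixes g :: "'b::euclidean_space \<Rightarrow> 'a \<Rightarrow> ereal"
  assumes g: "convex_normal_integrand M g"
    and aff: "\<And>\<omega>. \<omega> \<in> space M \<Longrightarrow> \<exists>a b. \<forall>z. g z \<omega> = ereal (a \<bullet> z + b)"
  shows "measurable_set_map M (\<lambda>\<omega>. {(z, b). g z \<omega> = ereal b})"
    and "\<And>\<omega>. \<omega> \<in> space M \<Longrightarrow> closed {(z, b). g z \<omega> = ereal b}"
proof -
  define r where "r z \<omega> = real_of_ereal (g z \<omega>)" for z \<omega>
  have graph: "{(z, b). g z \<omega> = ereal b} = {(z, b). b = r z \<omega>}" if "\<omega> \<in> space M" for \<omega>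
    using aff[OF that] unfolding r_def by force
  have cont: "continuous_on UNIV (\<lambda>z. r z \<omega>)" if \<omega>: "\<omega> \<in> space M" for \<omega>
  proof -
    obtain a b where "\<forall>z. g z \<omega> = ereal (a \<bullet> z + b)" using aff[OF \<omega>] by blast
    then have "(\<lambda>z. r z \<omega>) = (\<lambda>z. a \<bullet> z + b)" by (auto simp: r_def)
    then show ?thesis by (simp only:) (intro continuous_intros)
  qed
  show "closed {(z, b). g z \<omega> = ereal b}" if "\<omega> \<in> space M" for \<omega>
  proof -
    have "closed {x :: 'b \<times> real. snd x = r (fst x) \<omega>}"
      by (intro closed_Collect_eq continuous_intros continuous_on_compose2[OF cont[OF that]]) auto
    then show ?thesis unfolding graph[OF that] by (simp add: case_prod_beta')
  qed
  obtain D :: "'b set" where D: "countable D" "\<And>X. open X \<Longrightarrow> X \<noteq> {} \<Longrightarrow> \<exists>d\<in>D. d \<in> X"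
    using countable_dense_setE by blast
  have rM [measurable]: "r z \<in> borel_measurable M" for z
    using borel_measurable_normal_integrand[OF g, of "\<lambda>_. z"] by (simp add: r_def[abs_def])
  show "measurable_set_map M (\<lambda>\<omega>. {(z, b). g z \<omega> = ereal b})"
    unfolding measurable_set_map_def
  proof (intro allI impI)
    fix G :: "('b \<times> real) set" assume G: "open G"
    \<comment> \<open>The coefficients \<open>a\<close> and \<open>b\<close> come without any
      measurability in \<omega>. Continuity in \<open>z\<close> replaces it: the graph enters an
      open set iff it does so over a point of the countable dense \<open>D\<close>, and
      \<open>r q\<close> is measurable for fixed \<open>q\<close>.\<close>
    have "{(z, b). g z \<omega> = ereal b} \<inter> G \<noteq> {} \<longleftrightarrow> (\<exists>q\<in>D. (q, r q \<omega>) \<in> G)" if "\<omega> \<in> space M" for \<omega>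
    proof -
      have "open ((\<lambda>z. (z, r z \<omega>)) -` G)"
        using G by (intro open_vimage continuous_intros cont that)
      then have "(\<exists>z. (z, r z \<omega>) \<in> G) \<longleftrightarrow> (\<exists>q\<in>D. (q, r q \<omega>) \<in> G)"
        using D(2)[of "(\<lambda>z. (z, r z \<omega>)) -` G"] by auto
      then show ?thesis unfolding graph[OF that] by auto
    qed
    then have "{\<omega>\<in>space M. {(z, b). g z \<omega> = ereal b} \<inter> G \<noteq> {}} = {\<omega>\<in>space M. \<exists>q\<in>D. (q, r q \<omega>) \<in> G}"
      by blast
    also have "\<dots> \<in> sets M"
    proof (intro sets.sets_Collect_countable_Ex' D(1))
      fix q
      have "(\<lambda>\<omega>. (q, r q \<omega>)) \<in> borel_measurable M" by measurable
      then have "(\<lambda>\<omega>. (q, r q \<omega>)) -` G \<inter> space M \<in> sets M"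
        using G by (auto intro: measurable_sets)
      moreover have "(\<lambda>\<omega>. (q, r q \<omega>)) -` G \<inter> space M = {\<omega>\<in>space M. (q, r q \<omega>) \<in> G}" by auto
      ultimately show "{\<omega>\<in>space M. (q, r q \<omega>) \<in> G} \<in> sets M" by simp
    qed
    finally show "{\<omega>\<in>space M. {(z, b). g z \<omega> = ereal b} \<inter> G \<noteq> {}} \<in> sets M" .
  qed
qed

section \<open>The conjugate integrand: Fenchel's inequality, its equality case,
  measurability\<close>

lemma inner_polar_cone_nonpos: "u \<in> K \<Longrightarrow> y \<in> polar_cone K \<Longrightarrow> u \<bullet> y \<le> 0"
  by (simp add: polar_cone_def)

lemma zero_in_cone_K: "0 \<in> cone_K L"
  by (simp add: cone_K_def)

text \<open>Fenchel's inequality: an admissible pair is one competitor in the supremum.\<close>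

lemma conj_f_upper:
  assumes "x \<in> dom_H f \<omega>" "map_H f x \<omega> + u \<in> cone_K L"
  shows "ereal (x \<bullet> v + u \<bullet> y) - f0 x \<omega> \<le> conj_f L f0 f v y \<omega>"
proof -
  have "ereal (x \<bullet> v + u \<bullet> y) - integrand_f L f0 f x u \<omega> \<le> conj_f L f0 f v y \<omega>"
    unfolding conj_f_def by (rule SUP_upper2[of "(x, u)"]) auto
  then show ?thesis using assms by (simp add: integrand_f_def)
qed

text \<open>Pairs that violate the constraints contribute \<open>-\<infinity>\<close> to the
  supremum.\<close>

lemma conj_f_least:
  assumes "\<And>x u. x \<in> dom_H f \<omega> \<Longrightarrow> map_H f x \<omega> + u \<in> cone_K L \<Longrightarrow> ereal (x \<bullet> v + u \<bullet> y) - f0 x \<omega> \<le> c"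
  shows "conj_f L f0 f v y \<omega> \<le> c"
  unfolding conj_f_def using assms by (intro SUP_least) (auto simp: integrand_f_def)

text \<open>The right side is equality in Fenchel's inequality at \<open>(x, 0)\<close> with finite
  values. Two choices of the shift link the sides: \<open>u = 0\<close> at \<open>x\<close>,
  admissible by \<open>Hx\<close>, and \<open>u = - map_H f z \<omega>\<close> at any
  \<open>z\<close> of the domain, admissible because the cone contains 0. The latter turns a bound
  on the conjugate into the subgradient inequality.\<close>

lemma subdiff_complementarity_iff:
  assumes x: "x \<in> dom_H f \<omega>" and Hx: "map_H f x \<omega> \<in> cone_K L" and y: "y \<in> polar_cone (cone_K L)"
  shows "p \<in> subdiff (f0_plus_yH f0 f y \<omega>) x \<and> y \<bullet> map_H f x \<omega> = 0 \<longleftrightarrow>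
    (\<exists>c. f0 x \<omega> = ereal c \<and> conj_f L f0 f p y \<omega> = ereal (x \<bullet> p - c))"
proof
  assume *: "p \<in> subdiff (f0_plus_yH f0 f y \<omega>) x \<and> y \<bullet> map_H f x \<omega> = 0"
  then have gx: "f0_plus_yH f0 f y \<omega> x = f0 x \<omega>"
    using x by (simp add: f0_plus_yH_def)
  with * obtain c where c: "f0 x \<omega> = ereal c"
    by (cases "f0 x \<omega>") (auto simp: subdiff_def)
  have sub: "ereal c + ereal (p \<bullet> (z - x)) \<le> f0_plus_yH f0 f y \<omega> z" for z
    using * gx c by (simp add: subdiff_def)
  have "conj_f L f0 f p y \<omega> \<le> ereal (x \<bullet> p - c)"
  proof (rule conj_f_least)
    fix z u assume z: "z \<in> dom_H f \<omega>" and u: "map_H f z \<omega> + u \<in> cone_K L"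
    have "ereal c + ereal (p \<bullet> (z - x)) \<le> f0 z \<omega> + ereal (y \<bullet> map_H f z \<omega>)"
      using sub[of z] z by (simp add: f0_plus_yH_def)
    \<comment> \<open>Polarity absorbs the shift: \<open>u \<bullet> y\<close> is at most
      \<open>- (map_H f z \<omega> \<bullet> y)\<close>.\<close>
    moreover have "(map_H f z \<omega> + u) \<bullet> y \<le> 0"
      using inner_polar_cone_nonpos[OF u y] .
    ultimately show "ereal (z \<bullet> p + u \<bullet> y) - f0 z \<omega> \<le> ereal (x \<bullet> p - c)"
      by (cases "f0 z \<omega>") (auto simp: algebra_simps inner_simps inner_commute)
  qed
  moreover have "ereal (x \<bullet> p - c) \<le> conj_f L f0 f p y \<omega>"
    using conj_f_upper[of x f \<omega> 0 L p y f0] x Hx c by simp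
  ultimately show "\<exists>c. f0 x \<omega> = ereal c \<and> conj_f L f0 f p y \<omega> = ereal (x \<bullet> p - c)"
    using c by (auto intro: antisym)
next
  assume "\<exists>c. f0 x \<omega> = ereal c \<and> conj_f L f0 f p y \<omega> = ereal (x \<bullet> p - c)"
  then obtain c where c: "f0 x \<omega> = ereal c" "conj_f L f0 f p y \<omega> = ereal (x \<bullet> p - c)" by blast
  have up: "ereal (z \<bullet> p - y \<bullet> map_H f z \<omega>) - f0 z \<omega> \<le> ereal (x \<bullet> p - c)" if "z \<in> dom_H f \<omega>" for z
    using conj_f_upper[of z f \<omega> "- map_H f z \<omega>" L p y f0] that zero_in_cone_K[of L] c(2)
    by (simp add: inner_commute)
  have "map_H f x \<omega> \<bullet> y \<le> 0"
    using inner_polar_cone_nonpos[OF Hx y] .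
  \<comment> \<open>The bound \<open>up\<close> at \<open>z = x\<close> gives the sign opposite to
    that of polarity.\<close>
  moreover have "0 \<le> y \<bullet> map_H f x \<omega>"
    using up[OF x] c(1) by simp
  ultimately have comp: "y \<bullet> map_H f x \<omega> = 0" by (simp add: inner_commute)
  have "ereal c + ereal (p \<bullet> (z - x)) \<le> f0_plus_yH f0 f y \<omega> z" for z
  proof (cases "z \<in> dom_H f \<omega>")
    case True
    then show ?thesis
      using up[OF True] by (cases "f0 z \<omega>") (auto simp: f0_plus_yH_def algebra_simps inner_simps inner_commute)
  qed (simp add: f0_plus_yH_def)
  then show "p \<in> subdiff (f0_plus_yH f0 f y \<omega>) x \<and> y \<bullet> map_H f x \<omega> = 0"
    using comp c(1) x by (simp add: subdiff_def f0_plus_yH_def)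
qed

text \<open>With \<open>a = - u\<close> the conjugate becomes the support function, in the direction
  \<open>(p, -1, -y)\<close>, of the common epigraph of objective and constraints, where the
  equality constraints contribute their graphs. A support function of a measurable mapping is
  measurable.\<close>

lemma conj_f_eq_SUP_epi:
  fixes f :: "'m::finite \<Rightarrow> 'b::real_inner \<Rightarrow> 'a \<Rightarrow> ereal"
  assumes y: "y \<in> polar_cone (cone_K L)" and fm: "\<And>j z. f j z \<omega> \<noteq> -\<infinity>"
  shows "conj_f L f0 f p y \<omega> =
    (SUP z\<in>{(x, a0, a). f0 x \<omega> \<le> ereal a0 \<and> (\<forall>j\<in>L. f j x \<omega> \<le> ereal (a $ j)) \<and> (\<forall>j\<in>-L. f j x \<omega> = ereal (a $ j))}.
      ereal ((p, -1, -y) \<bullet> z))" (is "_ = (SUP z\<in>?C. _)")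
proof (rule antisym)
  show "conj_f L f0 f p y \<omega> \<le> (SUP z\<in>?C. ereal ((p, -1, -y) \<bullet> z))"
  proof (rule conj_f_least)
    fix x u assume x: "x \<in> dom_H f \<omega>" and u: "map_H f x \<omega> + u \<in> cone_K L"
    let ?S = "SUP z\<in>?C. ereal ((p, -1, -y) \<bullet> z)"
    have fx: "f j x \<omega> = ereal (map_H f x \<omega> $ j)" for j
      using x fm[of j x] by (cases "f j x \<omega>") (auto simp: dom_H_def eff_dom_def map_H_def)
    have uy: "(map_H f x \<omega> + u) \<bullet> y \<le> 0"
      using inner_polar_cone_nonpos[OF u y] .
    \<comment> \<open>By polarity \<open>a = map_H f x \<omega>\<close> does at least as well as any
      admissible shift \<open>u\<close>.\<close>
    have le: "ereal (x \<bullet> p + u \<bullet> y - r) \<le> ?S" if "f0 x \<omega> \<le> ereal r" for r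
      using that fx uy
      by (intro SUP_upper2[of "(x, r, map_H f x \<omega>)"]) (auto simp: algebra_simps inner_simps inner_commute)
    show "ereal (x \<bullet> p + u \<bullet> y) - f0 x \<omega> \<le> ?S"
    proof (cases "f0 x \<omega>")
      case (real r)
      then show ?thesis using le[of r] by simp
    next
      case MInf
      \<comment> \<open>An objective value \<open>-\<infinity>\<close> admits every height
        \<open>a0\<close>, so the supremum is unbounded.\<close>
      have "?S = \<infinity>"
      proof (rule ereal_top)
        fix B :: real
        show "ereal B \<le> ?S" using le[of "x \<bullet> p + u \<bullet> y - B"] MInf by simp
      qed
      then show ?thesis by simp
    qed simp
  qed
  show "(SUP z\<in>?C. ereal ((p, -1, -y) \<bullet> z)) \<le> conj_f L f0 f p y \<omega>"
  proof (rule SUP_least)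
    fix z assume "z \<in> ?C"
    then obtain x a0 a where z: "z = (x, a0, a)" and a0: "f0 x \<omega> \<le> ereal a0"
      and aL: "\<forall>j\<in>L. f j x \<omega> \<le> ereal (a $ j)" and aE: "\<forall>j\<in>-L. f j x \<omega> = ereal (a $ j)" by auto
    have *: "f j x \<omega> \<le> ereal (a $ j)" for j
      using aL aE by (cases "j \<in> L") auto
    have "f j x \<omega> < \<infinity>" for j
      using *[of j] by (cases "f j x \<omega>") auto
    then have x: "x \<in> dom_H f \<omega>"
      by (simp add: dom_H_def eff_dom_def)
    have fx: "f j x \<omega> = ereal (map_H f x \<omega> $ j)" for j
      using x fm[of j x] by (cases "f j x \<omega>") (auto simp: dom_H_def eff_dom_def map_H_def)
    \<comment> \<open>The shift \<open>- a\<close> leaves a nonpositive remainder in the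
      inequalities and zero in the equalities.\<close>
    have "map_H f x \<omega> + - a \<in> cone_K L"
      using aL aE fx by (auto simp: cone_K_def)
    then have "ereal (x \<bullet> p + - a \<bullet> y) - f0 x \<omega> \<le> conj_f L f0 f p y \<omega>"
      by (intro conj_f_upper x)
    moreover have "ereal ((p, -1, -y) \<bullet> z) \<le> ereal (x \<bullet> p + - a \<bullet> y) - f0 x \<omega>"
      using a0 by (cases "f0 x \<omega>") (auto simp: z inner_commute)
    ultimately show "ereal ((p, -1, -y) \<bullet> z) \<le> conj_f L f0 f p y \<omega>" by (rule order_trans[rotated])
  qed
qed

text \<open>The support function formula is available where \<open>y \<omega>\<close> lies in the
  polar cone, which is almost everywhere; hence a measurable version \<open>\<psi>\<close>. Its
  underlying set is a finite intersection of closed measurable mappings.\<close>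

lemma borel_measurable_conj_f:
  fixes f :: "'m::finite \<Rightarrow> 'b::euclidean_space \<Rightarrow> 'a \<Rightarrow> ereal"
  assumes f0: "convex_normal_integrand M f0" and f: "\<And>j. convex_normal_integrand M (f j)"
    and fm: "\<And>j z \<omega>. \<omega> \<in> space M \<Longrightarrow> f j z \<omega> \<noteq> -\<infinity>"
    and aff: "\<And>j \<omega>. j \<notin> L \<Longrightarrow> \<omega> \<in> space M \<Longrightarrow> \<exists>a b. \<forall>z. f j z \<omega> = ereal (a \<bullet> z + b)"
    and [measurable]: "p \<in> borel_measurable M" "y \<in> borel_measurable M"
    and y: "AE \<omega> in M. y \<omega> \<in> polar_cone (cone_K L)"
  obtains \<psi> where "\<psi> \<in> borel_measurable M" "AE \<omega> in M. conj_f L f0 f (p \<omega>) (y \<omega>) \<omega> = \<psi> \<omega>"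
proof
  \<comment> \<open>\<open>None\<close> stands for the objective and \<open>Some j\<close> for a
    constraint. Each epigraph or graph is pulled back along a coordinate projection to the common
    space of triples \<open>(x, a0, a)\<close>.\<close>
  define E where "E i \<omega> = (case i of
      None \<Rightarrow> (\<lambda>(x, a0, a). (x, a0)) -` epi (\<lambda>x. f0 x \<omega>)
    | Some j \<Rightarrow> (\<lambda>(x, a0, a). (x, a $ j)) -`
        (if j \<in> L then epi (\<lambda>x. f j x \<omega>) else {(x, b). f j x \<omega> = ereal b}))"
    for i and \<omega>
  have lin: "linear (\<lambda>(x :: 'b, a0 :: real, a :: real^'m). (x, a0))"
    "linear (\<lambda>(x :: 'b, a0 :: real, a :: real^'m). (x, a $ j))" for j
    by (auto intro!: linearI)
  have "(x, b) \<in> range (\<lambda>(x :: 'b, a0 :: real, a :: real^'m). (x, a0))"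
    "(x, b) \<in> range (\<lambda>(x :: 'b, a0 :: real, a :: real^'m). (x, a $ j))" for x b j
    by (auto intro: image_eqI[of _ _ "(x, b, 0)"] image_eqI[of _ _ "(x, 0, \<chi> i. b)"])
  then have surj: "surj (\<lambda>(x :: 'b, a0 :: real, a :: real^'m). (x, a0))"
    "surj (\<lambda>(x :: 'b, a0 :: real, a :: real^'m). (x, a $ j))" for j
    by auto
  have Em: "measurable_set_map M (\<lambda>\<omega>. if j \<in> L then epi (\<lambda>x. f j x \<omega>) else {(x, b). f j x \<omega> = ereal b})" for j
    using convex_normal_integrandD(1)[OF f] measurable_set_map_affine_graph(1)[OF f aff]
    by (cases "j \<in> L") simp_all
  have Ec: "closed (if j \<in> L then epi (\<lambda>x. f j x \<omega>) else {(x, b). f j x \<omega> = ereal b})"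
    if "\<omega> \<in> space M" for j \<omega>
    using convex_normal_integrandD(2)[OF f that] measurable_set_map_affine_graph(2)[OF f aff that]
    by (cases "j \<in> L") simp_all
  have "measurable_set_map M (E i)" for i
    unfolding E_def[abs_def] using convex_normal_integrandD(1)[OF f0] Em
    by (cases i) (simp_all add: measurable_set_map_vimage_linear lin surj)
  moreover have "closed (E i \<omega>)" if "\<omega> \<in> space M" for i \<omega>
    unfolding E_def using convex_normal_integrandD(2)[OF f0 that] Ec[OF that]
    by (cases i) (simp_all add: closed_vimage linear_continuous_on linear_linear lin)
  ultimately have E: "measurable_set_map M (\<lambda>\<omega>. \<Inter>i\<in>UNIV. E i \<omega>)"
    by (intro measurable_set_map_INT) auto
  let ?\<psi> = "\<lambda>\<omega>. SUP z\<in>(\<Inter>i\<in>UNIV. E i \<omega>). ereal ((p \<omega>, -1, - y \<omega>) \<bullet> z)"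
  show "?\<psi> \<in> borel_measurable M"
    by (rule borel_measurable_SUP_set_map[OF E]) measurable
  have C: "(\<Inter>i\<in>UNIV. E i \<omega>) = {(x, a0, a). f0 x \<omega> \<le> ereal a0 \<and>
      (\<forall>j\<in>L. f j x \<omega> \<le> ereal (a $ j)) \<and> (\<forall>j\<in>-L. f j x \<omega> = ereal (a $ j))}" for \<omega>
    unfolding UNIV_option_conv E_def by (auto simp: epi_def split: if_splits)
  show "AE \<omega> in M. conj_f L f0 f (p \<omega>) (y \<omega>) \<omega> = ?\<psi> \<omega>"
    using y AE_space
  proof eventually_elim
    case (elim \<omega>)
    show ?case unfolding C by (rule conj_f_eq_SUP_epi[where f = f and \<omega> = \<omega>, OF elim(1) fm[OF elim(2)]])
  qed
qed

section \<open>Duality between the two stochastic problems\<close>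

locale stochastic_mp = prob_space M
  for M :: "'a measure" +
  fixes F :: "nat \<Rightarrow> 'a measure" and T :: nat
    and \<tau> :: "'n::finite \<Rightarrow> nat"
    and f0 :: "real^'n \<Rightarrow> 'a \<Rightarrow> ereal"
    and f :: "'m::finite \<Rightarrow> real^'n \<Rightarrow> 'a \<Rightarrow> ereal"
    and L :: "'m set"
    and X V :: "('a \<Rightarrow> real^'n) set"
    and U Y :: "('a \<Rightarrow> real^'m) set"
  assumes filtration: "\<And>t. t \<le> T \<Longrightarrow> subalgebra M (F t)"
      "\<And>s t. s \<le> t \<Longrightarrow> t \<le> T \<Longrightarrow> sets (F s) \<subseteq> sets (F t)"
    and \<tau>: "\<And>i. \<tau> i \<le> T"
    and f0: "convex_normal_integrand M f0"
    and f: "\<And>j. convex_normal_integrand M (f j)"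
    and f_not_MInf: "\<And>j z \<omega>. \<omega> \<in> space M \<Longrightarrow> f j z \<omega> \<noteq> -\<infinity>"
    and f_affine: "\<And>j \<omega>. j \<notin> L \<Longrightarrow> \<omega> \<in> space M \<Longrightarrow> \<exists>a b. \<forall>z. f j z \<omega> = ereal (a \<bullet> z + b)"
    and XV: "dual_pair M X V" and UY: "dual_pair M U Y"
    and E_f_finite: "\<exists>x\<in>X. \<exists>u\<in>U. E_f M L f0 f x u < \<infinity>"
begin

abbreviation "N \<equiv> adapted_space M F \<tau>"
abbreviation "P \<equiv> annihilator M V (X \<inter> N)"

lemma borel_measurable_integrand_f:
  assumes [measurable]: "x \<in> borel_measurable M" "u \<in> borel_measurable M"
  shows "(\<lambda>\<omega>. integrand_f L f0 f (x \<omega>) (u \<omega>) \<omega>) \<in> borel_measurable M"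
proof -
  have [measurable]: "(\<lambda>\<omega>. f0 (x \<omega>) \<omega>) \<in> borel_measurable M" "(\<lambda>\<omega>. f j (x \<omega>) \<omega>) \<in> borel_measurable M" for j
    using borel_measurable_normal_integrand[OF f0] borel_measurable_normal_integrand[OF f] by auto
  have [measurable]: "(\<lambda>\<omega>. u \<omega> $ j) \<in> borel_measurable M" for j
    by (rule borel_measurable_continuous_on[OF _ assms(2)]) (intro continuous_intros)
  have "(\<lambda>\<omega>. integrand_f L f0 f (x \<omega>) (u \<omega>) \<omega>) =
    (\<lambda>\<omega>. if (\<forall>j. f j (x \<omega>) \<omega> < \<infinity>) \<and> (\<forall>j\<in>L. real_of_ereal (f j (x \<omega>) \<omega>) + u \<omega> $ j \<le> 0) \<and>
      (\<forall>j\<in>-L. real_of_ereal (f j (x \<omega>) \<omega>) + u \<omega> $ j = 0) then f0 (x \<omega>) \<omega> else \<infinity>)"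
    by (simp add: integrand_f_def dom_H_def eff_dom_def cone_K_def map_H_def)
  also have "\<dots> \<in> borel_measurable M" by measurable
  finally show ?thesis .
qed

lemma MP_constrD:
  assumes "x \<in> MP_constr M N L f"
  shows "x \<in> N" "AE \<omega> in M. x \<omega> \<in> dom_H f \<omega> \<and> map_H f (x \<omega>) \<omega> \<in> cone_K L"
proof -
  show "x \<in> N" using assms by (simp add: MP_constr_def)
  have "AE \<omega> in M. (\<forall>j\<in>L. f j (x \<omega>) \<omega> \<le> 0) \<and> (\<forall>j\<in>-L. f j (x \<omega>) \<omega> = 0)"
    using assms by (simp add: MP_constr_def)
  with AE_space show "AE \<omega> in M. x \<omega> \<in> dom_H f \<omega> \<and> map_H f (x \<omega>) \<omega> \<in> cone_K L"
  proof eventually_elim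
    case (elim \<omega>)
    have le: "f j (x \<omega>) \<omega> \<le> 0" for j using elim(2) by (cases "j \<in> L") auto
    have "f j (x \<omega>) \<omega> < \<infinity> \<and> real_of_ereal (f j (x \<omega>) \<omega>) \<le> 0" for j
      using le[of j] by (cases "f j (x \<omega>) \<omega>") auto
    then show ?case
      using elim(2) by (auto simp: dom_H_def eff_dom_def cone_K_def map_H_def)
  qed
qed

lemma DMP_constrD:
  assumes "(p, y) \<in> DMP_constr M P Y L"
  shows "p \<in> P" "y \<in> Y" "AE \<omega> in M. y \<omega> \<in> polar_cone (cone_K L)"
    "p \<in> borel_measurable M" "y \<in> borel_measurable M"
  using assms XV UY by (auto simp: DMP_constr_def annihilator_def dual_pair_def linear_rv_space_def)

lemma N_measurable: "x \<in> N \<Longrightarrow> x \<in> borel_measurable M"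
  by (simp add: adapted_space_def)

text \<open>Dual feasibility bounds the conjugate from above. The bound from below is Fenchel's
  inequality at a point of \<open>X\<close> and \<open>U\<close> with \<open>E_f\<close> below
  \<open>\<infinity>\<close>, where the pairings with \<open>p\<close> and \<open>y\<close> are
  integrable; this is where the domain condition enters.\<close>

lemma DMP_feasible_conj_f_integrable:
  assumes feas: "(p, y) \<in> DMP_feasible M P Y L f0 f"
  obtains \<psi> where "integrable M \<psi>" "AE \<omega> in M. conj_f L f0 f (p \<omega>) (y \<omega>) \<omega> = ereal (\<psi> \<omega>)"
proof -
  have "(p, y) \<in> DMP_constr M P Y L" using feas by (simp add: DMP_feasible_def)
  note d = DMP_constrD[OF this]
  obtain \<psi> where \<psi> [measurable]: "\<psi> \<in> borel_measurable M"
    and eq: "AE \<omega> in M. conj_f L f0 f (p \<omega>) (y \<omega>) \<omega> = \<psi> \<omega>"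
    using borel_measurable_conj_f[where f = f and L = L, OF f0 f f_not_MInf f_affine d(4,5,3)] by blast
  have "ext_expectation M \<psi> = E_conj_f M L f0 f p y"
    unfolding E_conj_f_def by (rule ext_expectation_cong_AE) (use eq in \<open>eventually_elim, simp\<close>)
  also have "\<dots> < \<infinity>" using feas by (simp add: DMP_feasible_def)
  finally obtain h where h: "integrable M h" "AE \<omega> in M. \<psi> \<omega> \<le> ereal (h \<omega>)"
    using ext_expectation_less_top_upper_bound[OF \<psi>] by blast
  obtain x u where xu: "x \<in> X" "u \<in> U" "E_f M L f0 f x u < \<infinity>" using E_f_finite by blast
  have xu_meas: "x \<in> borel_measurable M" "u \<in> borel_measurable M"
    using xu XV UY by (auto simp: dual_pair_def linear_rv_space_def)
  obtain g where g: "integrable M g" "AE \<omega> in M. integrand_f L f0 f (x \<omega>) (u \<omega>) \<omega> \<le> ereal (g \<omega>)"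
    using ext_expectation_less_top_upper_bound[OF borel_measurable_integrand_f[OF xu_meas] xu(3)[unfolded E_f_def]]
    by blast
  have "p \<in> V" using d(1) by (simp add: annihilator_def)
  then have pair: "integrable M (\<lambda>\<omega>. x \<omega> \<bullet> p \<omega>)" "integrable M (\<lambda>\<omega>. u \<omega> \<bullet> y \<omega>)"
    using XV UY xu(1,2) d(2) by (simp_all add: dual_pair_def separating_duality_def)
  have "AE \<omega> in M. ereal (x \<omega> \<bullet> p \<omega> + u \<omega> \<bullet> y \<omega> - g \<omega>) \<le> \<psi> \<omega>"
    using g(2) eq
  proof eventually_elim
    case (elim \<omega>)
    then have "integrand_f L f0 f (x \<omega>) (u \<omega>) \<omega> \<noteq> \<infinity>" by auto
    then have "x \<omega> \<in> dom_H f \<omega>" "map_H f (x \<omega>) \<omega> + u \<omega> \<in> cone_K L"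
      and f0_le: "f0 (x \<omega>) \<omega> \<le> ereal (g \<omega>)"
      using elim(1) by (auto simp: integrand_f_def split: if_splits)
    then have "ereal (x \<omega> \<bullet> p \<omega> + u \<omega> \<bullet> y \<omega>) - f0 (x \<omega>) \<omega> \<le> \<psi> \<omega>"
      using conj_f_upper[of "x \<omega>" f \<omega> "u \<omega>" L "p \<omega>" "y \<omega>" f0] elim(2) by simp
    moreover have "ereal (x \<omega> \<bullet> p \<omega> + u \<omega> \<bullet> y \<omega> - g \<omega>) \<le> ereal (x \<omega> \<bullet> p \<omega> + u \<omega> \<bullet> y \<omega>) - f0 (x \<omega>) \<omega>"
      using f0_le by (cases "f0 (x \<omega>) \<omega>") auto
    ultimately show ?case by (rule order_trans[rotated])
  qed
  moreover have "integrable M (\<lambda>\<omega>. x \<omega> \<bullet> p \<omega> + u \<omega> \<bullet> y \<omega> - g \<omega>)"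
    using pair g(1) by auto
  ultimately have "integrable M (\<lambda>\<omega>. real_of_ereal (\<psi> \<omega>))"
    and \<psi>_eq: "AE \<omega> in M. \<psi> \<omega> = ereal (real_of_ereal (\<psi> \<omega>))"
    using integrable_version_between[OF \<psi> _ h(1) _ h(2)] by blast+
  moreover have "AE \<omega> in M. conj_f L f0 f (p \<omega>) (y \<omega>) \<omega> = ereal (real_of_ereal (\<psi> \<omega>))"
    using eq \<psi>_eq by eventually_elim simp
  ultimately show ?thesis using that by blast
qed

text \<open>The gap \<open>a + b\<close> is the integral of the defect in Fenchel's inequality. The
  order of the integrability claims matters: first the conjugate, then the inner product of
  \<open>x\<close> and \<open>p\<close>, and only then the objective.\<close>

lemma duality_gap:
  assumes x: "x \<in> MP_feasible M N L f0 f" and py: "(p, y) \<in> DMP_feasible M P Y L f0 f"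
  obtains a b where "E_f0 M f0 x = ereal a" "E_conj_f M L f0 f p y = ereal b" "0 \<le> a + b"
    "a + b = 0 \<longleftrightarrow> (AE \<omega> in M. p \<omega> \<in> subdiff (f0_plus_yH f0 f (y \<omega>) \<omega>) (x \<omega>) \<and>
      x \<omega> \<in> dom_H f \<omega> \<and> map_H f (x \<omega>) \<omega> \<in> cone_K L \<and> y \<omega> \<in> polar_cone (cone_K L) \<and>
      y \<omega> \<bullet> map_H f (x \<omega>) \<omega> = 0)"
proof -
  have "(p, y) \<in> DMP_constr M P Y L" using py by (simp add: DMP_feasible_def)
  note d = DMP_constrD[OF this]
  have "x \<in> MP_constr M N L f" using x by (simp add: MP_feasible_def)
  note c = MP_constrD[OF this]
  obtain \<psi> where \<psi>: "integrable M \<psi>" "AE \<omega> in M. conj_f L f0 f (p \<omega>) (y \<omega>) \<omega> = ereal (\<psi> \<omega>)"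
    using DMP_feasible_conj_f_integrable[OF py] by blast
  have f0x: "(\<lambda>\<omega>. f0 (x \<omega>) \<omega>) \<in> borel_measurable M"
    using borel_measurable_normal_integrand[OF f0 N_measurable[OF c(1)]] .
  have "ext_expectation M (\<lambda>\<omega>. f0 (x \<omega>) \<omega>) < \<infinity>"
    using x by (simp add: MP_feasible_def E_f0_def)
  then obtain h where h: "integrable M h" "AE \<omega> in M. f0 (x \<omega>) \<omega> \<le> ereal (h \<omega>)"
    using ext_expectation_less_top_upper_bound[OF f0x] by blast
  have fenchel: "AE \<omega> in M. ereal (x \<omega> \<bullet> p \<omega> - \<psi> \<omega>) \<le> f0 (x \<omega>) \<omega>"
    using c(2) \<psi>(2)
  proof eventually_elim
    case (elim \<omega>)
    then show ?case
      using conj_f_upper[of "x \<omega>" f \<omega> 0 L "p \<omega>" "y \<omega>" f0] by (cases "f0 (x \<omega>) \<omega>") auto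
  qed
  \<comment> \<open>The bounds combine to the integrable upper bound under which \<open>x\<close>
    and \<open>p\<close> are orthogonal.\<close>
  have "AE \<omega> in M. x \<omega> \<bullet> p \<omega> \<le> h \<omega> + \<psi> \<omega>"
    using fenchel h(2)
  proof eventually_elim
    case (elim \<omega>)
    then have "ereal (x \<omega> \<bullet> p \<omega> - \<psi> \<omega>) \<le> ereal (h \<omega>)" by (rule order_trans)
    then show ?case by simp
  qed
  then have xp: "integrable M (\<lambda>\<omega>. x \<omega> \<bullet> p \<omega>)" "(\<integral>\<omega>. x \<omega> \<bullet> p \<omega> \<partial>M) = 0"
    using adapted_inner_annihilator[OF prob_space_axioms filtration \<tau> XV c(1) d(1)
        Bochner_Integration.integrable_add[OF h(1) \<psi>(1)]] by auto
  let ?\<phi> = "\<lambda>\<omega>. real_of_ereal (f0 (x \<omega>) \<omega>)"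
  \<comment> \<open>Now that the inner product is integrable, \<open>fenchel\<close> is an
    integrable lower bound for the objective.\<close>
  have \<phi>: "integrable M ?\<phi>" "AE \<omega> in M. f0 (x \<omega>) \<omega> = ereal (?\<phi> \<omega>)"
    using integrable_version_between[OF f0x _ h(1) fenchel h(2)] xp(1) \<psi>(1) by auto
  let ?g = "\<lambda>\<omega>. ?\<phi> \<omega> + \<psi> \<omega> - x \<omega> \<bullet> p \<omega>"
  have g: "integrable M ?g" "(\<integral>\<omega>. ?g \<omega> \<partial>M) = (\<integral>\<omega>. ?\<phi> \<omega> \<partial>M) + (\<integral>\<omega>. \<psi> \<omega> \<partial>M)"
    using \<phi>(1) \<psi>(1) xp by simp_all
  have g_nonneg: "AE \<omega> in M. 0 \<le> ?g \<omega>"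
    using fenchel \<phi>(2)
  proof eventually_elim
    case (elim \<omega>)
    then have "ereal (x \<omega> \<bullet> p \<omega> - \<psi> \<omega>) \<le> ereal (?\<phi> \<omega>)" by simp
    then show ?case by simp
  qed
  have "(\<integral>\<omega>. ?g \<omega> \<partial>M) = 0 \<longleftrightarrow> (AE \<omega> in M. ?g \<omega> = 0)"
    by (rule integral_nonneg_eq_0_iff_AE[OF g(1) g_nonneg])
  also have "\<dots> \<longleftrightarrow> (AE \<omega> in M. p \<omega> \<in> subdiff (f0_plus_yH f0 f (y \<omega>) \<omega>) (x \<omega>) \<and>
      x \<omega> \<in> dom_H f \<omega> \<and> map_H f (x \<omega>) \<omega> \<in> cone_K L \<and> y \<omega> \<in> polar_cone (cone_K L) \<and>
      y \<omega> \<bullet> map_H f (x \<omega>) \<omega> = 0)" (is "_ \<longleftrightarrow> (AE \<omega> in M. ?opt \<omega>)")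
  proof -
    have "AE \<omega> in M. ?g \<omega> = 0 \<longleftrightarrow> ?opt \<omega>"
      using c(2) d(3) \<phi>(2) \<psi>(2)
    proof eventually_elim
      case (elim \<omega>)
      have "?g \<omega> = 0 \<longleftrightarrow> (\<exists>c. f0 (x \<omega>) \<omega> = ereal c \<and> conj_f L f0 f (p \<omega>) (y \<omega>) \<omega> = ereal (x \<omega> \<bullet> p \<omega> - c))"
        unfolding elim(4) by (subst elim(3)) auto
      then show ?case
        using subdiff_complementarity_iff[of "x \<omega>" f \<omega> L "y \<omega>" "p \<omega>" f0] elim(1,2) by blast
    qed
    then show ?thesis by (rule eventually_subst)
  qed
  finally have "(\<integral>\<omega>. ?\<phi> \<omega> \<partial>M) + (\<integral>\<omega>. \<psi> \<omega> \<partial>M) = 0 \<longleftrightarrow> (AE \<omega> in M. ?opt \<omega>)"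
    unfolding g(2) .
  moreover have "0 \<le> (\<integral>\<omega>. ?\<phi> \<omega> \<partial>M) + (\<integral>\<omega>. \<psi> \<omega> \<partial>M)"
    using integral_nonneg_AE[OF g_nonneg] g(2) by simp
  ultimately show ?thesis
    using that ext_expectation_eq_integral[OF \<phi>] ext_expectation_eq_integral[OF \<psi>]
    unfolding E_f0_def E_conj_f_def by blast
qed

text \<open>If both expectations are below \<open>\<infinity>\<close>, the gap is nonnegative;
  otherwise the right side is \<open>\<infinity>\<close> or the left side is
  \<open>-\<infinity>\<close>.\<close>

lemma weak_duality:
  assumes x: "x \<in> MP_constr M N L f" and py: "(p, y) \<in> DMP_constr M P Y L"
  shows "- E_conj_f M L f0 f p y \<le> E_f0 M f0 x"
proof (cases "E_f0 M f0 x < \<infinity> \<and> E_conj_f M L f0 f p y < \<infinity>")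
  case True
  then have "x \<in> MP_feasible M N L f0 f" "(p, y) \<in> DMP_feasible M P Y L f0 f"
    using x py by (simp_all add: MP_feasible_def DMP_feasible_def)
  then obtain a b where "E_f0 M f0 x = ereal a" "E_conj_f M L f0 f p y = ereal b" "0 \<le> a + b"
    using duality_gap by blast
  then show ?thesis by simp
qed auto

text \<open>By weak duality a pair with equal values bounds all competitors in both problems, so
  each member is optimal and the optimum values agree.\<close>

lemma solves_iff:
  "MP_solves M N L f0 f x \<and> DMP_solves M P Y L f0 f p y \<and> MP_inf M N L f0 f = DMP_sup M P Y L f0 f \<longleftrightarrow>
   x \<in> MP_feasible M N L f0 f \<and> (p, y) \<in> DMP_feasible M P Y L f0 f \<and>
   E_f0 M f0 x = - E_conj_f M L f0 f p y" (is "?opt \<longleftrightarrow> ?gap")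
proof
  assume ?gap
  then have x: "x \<in> MP_constr M N L f" and py: "(p, y) \<in> DMP_constr M P Y L"
    and eq: "E_f0 M f0 x = - E_conj_f M L f0 f p y"
    by (auto simp: MP_feasible_def DMP_feasible_def)
  have "MP_inf M N L f0 f = E_f0 M f0 x"
    unfolding MP_inf_def using weak_duality[OF _ py] eq by (intro antisym INF_lower[OF x] INF_greatest) simp
  moreover have "DMP_sup M P Y L f0 f = - E_conj_f M L f0 f p y"
    unfolding DMP_sup_def using py weak_duality[OF x] eq by (intro SUP_eqI) force+
  ultimately show ?opt
    using \<open>?gap\<close> by (simp add: MP_solves_def DMP_solves_def)
qed (auto simp: MP_solves_def DMP_solves_def)

end

theorem theorem33:
  fixes M :: "'a measure"
    and F :: "nat \<Rightarrow> 'a measure" and T :: nat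
    and \<tau> :: "'n::finite \<Rightarrow> nat"
    and f0 :: "real^'n \<Rightarrow> 'a \<Rightarrow> ereal"
    and f :: "'m::finite \<Rightarrow> real^'n \<Rightarrow> 'a \<Rightarrow> ereal"
    and L :: "'m set"
    and X V :: "('a \<Rightarrow> real^'n) set"
    and U Y :: "('a \<Rightarrow> real^'m) set"
    and x p :: "'a \<Rightarrow> real^'n" and y :: "'a \<Rightarrow> real^'m"
  assumes "prob_space M"
    and "\<And>t. t \<le> T \<Longrightarrow> subalgebra M (F t)"
    and "\<And>s t. s \<le> t \<Longrightarrow> t \<le> T \<Longrightarrow> sets (F s) \<subseteq> sets (F t)"
    and "\<And>i. \<tau> i \<le> T"
    and "convex_normal_integrand M f0"
    and "\<And>j. convex_normal_integrand M (f j)"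
    and "\<And>j z \<omega>. \<omega> \<in> space M \<Longrightarrow> f j z \<omega> \<noteq> -\<infinity>"
    and "\<And>j \<omega>. j \<notin> L \<Longrightarrow> \<omega> \<in> space M \<Longrightarrow> \<exists>a b. \<forall>z. f j z \<omega> = ereal (a \<bullet> z + b)"
    and "dual_pair M X V"
    and "dual_pair M U Y"
    and "\<exists>x\<in>X. \<exists>u\<in>U. E_f M L f0 f x u < \<infinity>"
    and "MP_feasible M (adapted_space M F \<tau>) L f0 f \<noteq> {}"
    and "DMP_feasible M (annihilator M V (X \<inter> adapted_space M F \<tau>)) Y L f0 f \<noteq> {}"
  shows
    "(MP_solves M (adapted_space M F \<tau>) L f0 f x \<and>
      DMP_solves M (annihilator M V (X \<inter> adapted_space M F \<tau>)) Y L f0 f p y \<and>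
      MP_inf M (adapted_space M F \<tau>) L f0 f =
        DMP_sup M (annihilator M V (X \<inter> adapted_space M F \<tau>)) Y L f0 f)
     \<longleftrightarrow>
     (x \<in> MP_feasible M (adapted_space M F \<tau>) L f0 f \<and>
      (p, y) \<in> DMP_feasible M (annihilator M V (X \<inter> adapted_space M F \<tau>)) Y L f0 f \<and>
      (AE \<omega> in M.
         p \<omega> \<in> subdiff (f0_plus_yH f0 f (y \<omega>) \<omega>) (x \<omega>) \<and>
         x \<omega> \<in> dom_H f \<omega> \<and> map_H f (x \<omega>) \<omega> \<in> cone_K L \<and>
         y \<omega> \<in> polar_cone (cone_K L) \<and>
         y \<omega> \<bullet> map_H f (x \<omega>) \<omega> = 0))"
  proof -
  interpret prob_space M by fact
  interpret stochastic_mp M F T \<tau> f0 f L X V U Y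
    by unfold_locales (use assms in auto)
  show ?thesis
    unfolding solves_iff
  \<comment> \<open>Feasibility stands on both sides and may be assumed when a zero gap is compared
    with the pointwise conditions.\<close>
  proof (intro conj_cong refl)
    assume "x \<in> MP_feasible M N L f0 f" "(p, y) \<in> DMP_feasible M P Y L f0 f"
    then obtain a b where "E_f0 M f0 x = ereal a" "E_conj_f M L f0 f p y = ereal b"
      "a + b = 0 \<longleftrightarrow> (AE \<omega> in M. p \<omega> \<in> subdiff (f0_plus_yH f0 f (y \<omega>) \<omega>) (x \<omega>) \<and>
        x \<omega> \<in> dom_H f \<omega> \<and> map_H f (x \<omega>) \<omega> \<in> cone_K L \<and> y \<omega> \<in> polar_cone (cone_K L) \<and>
        y \<omega> \<bullet> map_H f (x \<omega>) \<omega> = 0)"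
      using duality_gap by blast
    \<comment> \<open>Both expectations are real, so the equality of values is
      \<open>a + b = 0\<close>.\<close>
    then show "E_f0 M f0 x = - E_conj_f M L f0 f p y \<longleftrightarrow>
      (AE \<omega> in M. p \<omega> \<in> subdiff (f0_plus_yH f0 f (y \<omega>) \<omega>) (x \<omega>) \<and>
        x \<omega> \<in> dom_H f \<omega> \<and> map_H f (x \<omega>) \<omega> \<in> cone_K L \<and> y \<omega> \<in> polar_cone (cone_K L) \<and>
        y \<omega> \<bullet> map_H f (x \<omega>) \<omega> = 0)"
      by (simp add: eq_neg_iff_add_eq_0)
  qed
qed

end
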